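(* Let $t$ be a positive integer. There exists $d_0\in\mathbb{N}$ such that for all integers $d\ge d_0$, if $G$ is a $d$-degenerate $K_{1,t,t}$-free graph, then $$\chi_f^{\mathrm{DP}}(G)\le (16t+o(1))\frac{d}{\log d},$$ where $o(1)$ denotes a quantity depending only on $t$ and $d$ that tends to $0$ as $d\to\infty$ with $t$ fixed.
   Context: All graphs are finite, simple and undirected; $\log$ is the natural logarithm. A graph is $d$-degenerate if it admits a vertex ordering in which each vertex has at most $d$ neighbors preceding it. $K_{1,t,t}$ is the complete tripartite graph with parts of sizes $1,t,t$; a graph is $F$-free if it contains no (not necessarily induced) subgraph isomorphic to $F$. A DP-cover (correspondence cover) of $G$ is a pair $\mathcal{H}=(L,H)$ where $H$ is a graph and $L:V(G)\to 2^{V(H)}$ satisfies: (DP1) $\{L(v):v\in V(G)\}$ is a partition of $V(H)$; (DP2) each $L(v)$ is an independent set in $H$; (DP3) for all distinct $u,v\in V(G)$, the edge set of $H[L(u)\cup L(v)]$ is a matching, empty if $uv\notin E(G)$. It is $q$-fold if $|L(v)|=q$ for all $v$. For $\eta\in[0,1]$, an $(\eta,\mathcal{H})$-coloring of $G$ is an independent set $S\subseteq V(H)$ with $|S\cap L(u)|\ge\eta|L(u)|$ for all $u\in V(G)$. For $q\in\mathbb{N}^+$ let $\theta_{\mathrm{DP}}(G,q)$ be the maximum $\eta\in[0,1]$ such that $G$ admits an $(\eta,\mathcal{H})$-coloring for every $q$-fold DP-cover $\mathcal{H}$ of $G$. The fractional DP-chromatic number is $\chi_f^{\mathrm{DP}}(G)=\inf\{\theta_{\mathrm{DP}}(G,q)^{-1}: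 q\in\mathbb{N}^+\}$. *)

theory Defs
  imports
    "Graph_Theory.Digraph_Component"
    "Graph_Theory.Pair_Digraph"
    "HOL-Library.Disjoint_Sets"
    "HOL-Analysis.Analysis"
begin

text \<open>
  Finite simple undirected graphs are rendered by the locale predicate \<^const>\<open>pair_graph\<close>:
  finite vertex set, no loops, and a symmetric set of arcs, so that an edge
  between \<open>u\<close> and \<open>v\<close> is the pair of arcs \<open>(u, v)\<close>, \<open>(v, u)\<close>.
\<close>

definition degenerate :: "nat \<Rightarrow> 'a pair_pre_digraph \<Rightarrow> bool" where
  "degenerate d G \<longleftrightarrow>
     (\<exists>vs. distinct vs \<and> set vs = pverts G \<and>
        (\<forall>i < length vs. card {u \<in> set (take i vs). (u, vs ! i) \<in> parcs G} \<le> d))"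

definition complete_tripartite_digraph :: "nat \<Rightarrow> nat \<Rightarrow> nat \<Rightarrow> 'a pair_pre_digraph \<Rightarrow> bool" where
  "complete_tripartite_digraph l m n K \<longleftrightarrow> pair_graph K \<and>
     (\<exists>U V W. pverts K = U \<union> V \<union> W \<and> U \<inter> V = {} \<and> U \<inter> W = {} \<and> V \<inter> W = {} \<and>
        card U = l \<and> card V = m \<and> card W = n \<and>
        parcs K = U \<times> V \<union> V \<times> U \<union> U \<times> W \<union> W \<times> U \<union> V \<times> W \<union> W \<times> V)"

definition tripartite_free :: "nat \<Rightarrow> nat \<Rightarrow> nat \<Rightarrow> 'a pair_pre_digraph \<Rightarrow> bool" where
  "tripartite_free l m n G \<longleftrightarrow>
     \<not> (\<exists>K. subgraph (with_proj K) (with_proj G) \<and> complete_tripartite_digraph l m n K)"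

definition independent_set :: "'a pair_pre_digraph \<Rightarrow> 'a set \<Rightarrow> bool" where
  "independent_set G S \<longleftrightarrow> S \<subseteq> pverts G \<and> (\<forall>x\<in>S. \<forall>y\<in>S. (x, y) \<notin> parcs G)"

text \<open>
  In (DP3), the edge set of an induced subgraph of \<open>H\<close> is a symmetric set of arcs. It is a
  matching iff no vertex has two different neighbours in it, that is, iff it is single-valued.
\<close>

definition dp_cover :: "'a pair_pre_digraph \<Rightarrow> ('a \<Rightarrow> 'b set) \<Rightarrow> 'b pair_pre_digraph \<Rightarrow> bool" where
  "dp_cover G L H \<longleftrightarrow> pair_graph H \<and>
     (\<Union>v\<in>pverts G. L v) = pverts H \<and> disjoint_family_on L (pverts G) \<and>
     (\<forall>v\<in>pverts G. independent_set H (L v)) \<and>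
     (\<forall>u\<in>pverts G. \<forall>v\<in>pverts G. u \<noteq> v \<longrightarrow>
        single_valued (arcs (with_proj H \<restriction> (L u \<union> L v))) \<and>
        ((u, v) \<notin> parcs G \<longrightarrow> arcs (with_proj H \<restriction> (L u \<union> L v)) = {}))"

definition fold_dp_cover ::
    "nat \<Rightarrow> 'a pair_pre_digraph \<Rightarrow> ('a \<Rightarrow> 'b set) \<Rightarrow> 'b pair_pre_digraph \<Rightarrow> bool" where
  "fold_dp_cover q G L H \<longleftrightarrow> dp_cover G L H \<and> (\<forall>v\<in>pverts G. card (L v) = q)"

definition dp_coloring ::
    "real \<Rightarrow> 'a pair_pre_digraph \<Rightarrow> ('a \<Rightarrow> 'b set) \<Rightarrow> 'b pair_pre_digraph \<Rightarrow> 'b set \<Rightarrow> bool" where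
  "dp_coloring \<eta> G L H S \<longleftrightarrow> independent_set H S \<and>
     (\<forall>u\<in>pverts G. real (card (S \<inter> L u)) \<ge> \<eta> * real (card (L u)))"

text \<open>
  The cover graph is finite, so its vertices may be taken to be natural numbers; the lemma
  \<open>dp_colorable_any_cover\<close> below shows that covers on every other vertex type are accounted for.
\<close>

definition dp_colorable :: "real \<Rightarrow> 'a pair_pre_digraph \<Rightarrow> nat \<Rightarrow> bool" where
  "dp_colorable \<eta> G q \<longleftrightarrow>
     (\<forall>L (H :: nat pair_pre_digraph). fold_dp_cover q G L H \<longrightarrow> (\<exists>S. dp_coloring \<eta> G L H S))"

definition theta_dp :: "'a pair_pre_digraph \<Rightarrow> nat \<Rightarrow> real" where
  "theta_dp G q = (GREATEST \<eta>. 0 \<le> \<eta> \<and> \<eta> \<le> 1 \<and> dp_colorable \<eta> G q)"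

text \<open>
  The value \<open>theta_dp G q\<close> can be \<open>0\<close> (for instance when \<open>q = 1\<close> and \<open>G\<close> has an edge), and its
  reciprocal is then meant to be infinite. Over the reals \<open>inverse 0 = 0\<close> would corrupt the
  infimum, so it is taken in \<^typ>\<open>ereal\<close>, where \<open>inverse 0 = \<infinity>\<close>.
\<close>

definition frac_dp_chromatic :: "'a pair_pre_digraph \<Rightarrow> ereal" where
  "frac_dp_chromatic G = (INF q\<in>{1..}. inverse (ereal (theta_dp G q)))"

lemma dp_colorable_any_cover:
  fixes H :: "'b pair_pre_digraph"
  assumes "dp_colorable \<eta> G q" and cov: "fold_dp_cover q G L H"
  shows "\<exists>S. dp_coloring \<eta> G L H S"
proof -
  have pg: "pair_graph H" and un: "(\<Union>v\<in>pverts G. L v) = pverts H"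
    and dis: "disjoint_family_on L (pverts G)"
    and ind: "\<And>v. v \<in> pverts G \<Longrightarrow> independent_set H (L v)"
    and card_L: "\<And>v. v \<in> pverts G \<Longrightarrow> card (L v) = q"
    using cov by (auto simp: fold_dp_cover_def dp_cover_def)
  have sv: "single_valued (arcs (with_proj H \<restriction> (L u \<union> L v)))"
    and emp: "(u, v) \<notin> parcs G \<Longrightarrow> arcs (with_proj H \<restriction> (L u \<union> L v)) = {}"
    if "u \<in> pverts G" "v \<in> pverts G" "u \<noteq> v" for u v
    using cov that unfolding fold_dp_cover_def dp_cover_def by auto
  interpret H: pair_graph H by (rule pg)
  obtain f :: "'b \<Rightarrow> nat" where inj: "inj_on f (pverts H)"
    using H.pair_finite_verts finite_imp_inj_to_nat_seg by blast
  define H' where "H' = \<lparr>pverts = f ` pverts H, parcs = map_prod f f ` parcs H\<rparr>"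
  define L' where "L' = (\<lambda>v. f ` L v)"
  have sub: "L v \<subseteq> pverts H" if "v \<in> pverts G" for v using un that by auto
  have arc: "(f x, f y) \<in> parcs H' \<longleftrightarrow> (x, y) \<in> parcs H"
    if "x \<in> pverts H" "y \<in> pverts H" for x y
  proof
    assume "(f x, f y) \<in> parcs H'"
    then obtain a b where ab: "(a, b) \<in> parcs H" "f x = f a" "f y = f b"
      by (auto simp: H'_def)
    then have "x = a" "y = b"
      using that inj H.wellformed'[OF ab(1)] by (auto dest: inj_onD)
    with ab(1) show "(x, y) \<in> parcs H" by simp
  next
    assume "(x, y) \<in> parcs H"
    then have "map_prod f f (x, y) \<in> map_prod f f ` parcs H" by (rule imageI)
    then show "(f x, f y) \<in> parcs H'" by (simp add: H'_def)
  qed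
  have arcD: "\<exists>x y. a = f x \<and> b = f y \<and> (x, y) \<in> parcs H \<and> x \<in> pverts H \<and> y \<in> pverts H"
    if "(a, b) \<in> parcs H'" for a b
  proof -
    from that obtain x y where xy: "(x, y) \<in> parcs H" "a = f x" "b = f y"
      by (auto simp: H'_def)
    with H.wellformed'[OF xy(1)] show ?thesis by blast
  qed
  have memL: "f x \<in> L' v \<longleftrightarrow> x \<in> L v" if "x \<in> pverts H" "v \<in> pverts G" for x v
    unfolding L'_def by (rule inj_on_image_mem_iff[OF inj that(1) sub[OF that(2)]])
  have cardL: "card (L' v) = q" if "v \<in> pverts G" for v
    using card_image[OF inj_on_subset[OF inj sub[OF that]]] card_L[OF that] by (simp add: L'_def)
  have symH: "(y, x) \<in> parcs H" if "(x, y) \<in> parcs H" for x y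
    using H.pair_sym_arcs that by (auto simp: symmetric_def dest: symD)
  have pg': "pair_graph H'"
  proof unfold_locales
    show "symmetric (with_proj H')"
      unfolding symmetric_def with_proj_simps
    proof (rule symI)
      fix a b assume "(a, b) \<in> parcs H'"
      then obtain x y where "a = f x" "b = f y" "(x, y) \<in> parcs H" "x \<in> pverts H" "y \<in> pverts H"
        using arcD by blast
      then show "(b, a) \<in> parcs H'" using arc symH by simp
    qed
    fix e assume "e \<in> parcs H'"
    then have "(fst e, snd e) \<in> parcs H'" by simp
    then obtain x y where xy: "fst e = f x" "snd e = f y" "(x, y) \<in> parcs H"
      "x \<in> pverts H" "y \<in> pverts H"
      using arcD by blast
    then have "x \<noteq> y" using H.pair_no_loops[OF xy(3)] by simp
    with xy inj show "fst e \<noteq> snd e" by (simp add: inj_on_eq_iff)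
    show "fst e \<in> pverts H'" "snd e \<in> pverts H'" using xy by (simp_all add: H'_def)
  next
    show "finite (pverts H')" "finite (parcs H')"
      using H.pair_finite_verts H.pair_finite_arcs by (simp_all add: H'_def)
  qed
  have "dp_cover G L' H'"
    unfolding dp_cover_def
  proof (intro conjI ballI impI)
    show "pair_graph H'" by (rule pg')
    show "(\<Union>v\<in>pverts G. L' v) = pverts H'"
      unfolding un[symmetric] L'_def H'_def by (simp add: image_UN)
    show "disjoint_family_on L' (pverts G)"
      unfolding disjoint_family_on_def
    proof (intro ballI impI)
      fix u v assume uv: "u \<in> pverts G" "v \<in> pverts G" "u \<noteq> v"
      then have "L u \<inter> L v = {}" using dis by (simp add: disjoint_family_on_def)
      then show "L' u \<inter> L' v = {}"
        using inj_on_image_Int[OF inj sub[OF uv(1)] sub[OF uv(2)]] by (simp add: L'_def)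
    qed
    show "independent_set H' (L' v)" if v: "v \<in> pverts G" for v
      unfolding independent_set_def
    proof (intro conjI ballI)
      show "L' v \<subseteq> pverts H'" using sub[OF v] by (auto simp: L'_def H'_def)
      fix a b assume "a \<in> L' v" "b \<in> L' v"
      then obtain x y where xy: "a = f x" "b = f y" "x \<in> L v" "y \<in> L v" by (auto simp: L'_def)
      then have "(x, y) \<notin> parcs H" using ind[OF v] by (simp add: independent_set_def)
      then show "(a, b) \<notin> parcs H'" using xy arc sub[OF v] by (simp add: subsetD)
    qed
  next
    fix u v assume uv: "u \<in> pverts G" "v \<in> pverts G" "u \<noteq> v"
    have pull: "\<exists>x y. a = f x \<and> b = f y \<and> x \<in> pverts H \<and> y \<in> pverts H \<and>
        (x, y) \<in> arcs (with_proj H \<restriction> (L u \<union> L v))"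
      if ab: "(a, b) \<in> arcs (with_proj H' \<restriction> (L' u \<union> L' v))" for a b
    proof -
      from ab have "(a, b) \<in> parcs H'" and m: "a \<in> L' u \<union> L' v" "b \<in> L' u \<union> L' v"
        by (auto simp: induce_subgraph_def)
      with arcD obtain x y where xy: "a = f x" "b = f y" "(x, y) \<in> parcs H"
        "x \<in> pverts H" "y \<in> pverts H" by blast
      have "x \<in> L u \<union> L v" "y \<in> L u \<union> L v"
        using m memL[OF xy(4) uv(1)] memL[OF xy(4) uv(2)] memL[OF xy(5) uv(1)] memL[OF xy(5) uv(2)]
        by (simp_all add: xy(1,2))
      with xy show ?thesis by (auto simp: induce_subgraph_def)
    qed
    show "single_valued (arcs (with_proj H' \<restriction> (L' u \<union> L' v)))"
    proof (rule single_valuedI)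
      fix a b c
      assume b: "(a, b) \<in> arcs (with_proj H' \<restriction> (L' u \<union> L' v))"
        and c: "(a, c) \<in> arcs (with_proj H' \<restriction> (L' u \<union> L' v))"
      obtain x y where 1: "a = f x" "b = f y" "x \<in> pverts H"
        "(x, y) \<in> arcs (with_proj H \<restriction> (L u \<union> L v))" using pull[OF b] by blast
      obtain x' z where 2: "a = f x'" "c = f z" "x' \<in> pverts H"
        "(x', z) \<in> arcs (with_proj H \<restriction> (L u \<union> L v))" using pull[OF c] by blast
      have "x = x'" using inj_onD[OF inj, of x x'] 1 2 by simp
      then have "y = z" using single_valuedD[OF sv[OF uv], of x y z] 1(4) 2(4) by simp
      with 1 2 show "b = c" by simp
    qed
    show "arcs (with_proj H' \<restriction> (L' u \<union> L' v)) = {}" if "(u, v) \<notin> parcs G"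
    proof (rule equals0I)
      fix e assume "e \<in> arcs (with_proj H' \<restriction> (L' u \<union> L' v))"
      then have "(fst e, snd e) \<in> arcs (with_proj H' \<restriction> (L' u \<union> L' v))" by simp
      from pull[OF this] emp[OF uv that] show False by blast
    qed
  qed
  then have "fold_dp_cover q G L' H'" using cardL by (simp add: fold_dp_cover_def)
  with assms(1) obtain S where S: "dp_coloring \<eta> G L' H' S"
    unfolding dp_colorable_def by blast
  define T where "T = {x \<in> pverts H. f x \<in> S}"
  have "f ` (T \<inter> L u) = S \<inter> L' u" if u: "u \<in> pverts G" for u
    using sub[OF u] by (auto simp: T_def L'_def)
  then have eq: "f ` (T \<inter> L u) = S \<inter> L' u" if "u \<in> pverts G" for u using that by blast
  have "card (T \<inter> L u) = card (S \<inter> L' u)" if "u \<in> pverts G" for u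
  proof -
    have "inj_on f (T \<inter> L u)" by (rule inj_on_subset[OF inj]) (auto simp: T_def)
    from card_image[OF this] show ?thesis by (simp add: eq[OF that])
  qed
  moreover have "independent_set H T"
    unfolding independent_set_def
  proof (intro conjI ballI)
    show "T \<subseteq> pverts H" by (auto simp: T_def)
    fix x y assume xy: "x \<in> T" "y \<in> T"
    then have "(f x, f y) \<notin> parcs H'"
      using S by (simp add: dp_coloring_def independent_set_def T_def)
    with xy arc[of x y] show "(x, y) \<notin> parcs H" by (simp add: T_def)
  qed
  ultimately have "dp_coloring \<eta> G L H T"
    using S card_L cardL by (simp add: dp_coloring_def)
  then show ?thesis by blast
qed

lemma theta_dp_is_maximum:
  shows "0 \<le> theta_dp G q \<and> theta_dp G q \<le> 1 \<and> dp_colorable (theta_dp G q) G q"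
    and "0 \<le> \<eta> \<Longrightarrow> \<eta> \<le> 1 \<Longrightarrow> dp_colorable \<eta> G q \<Longrightarrow> \<eta> \<le> theta_dp G q"
proof -
  define P where "P = (\<lambda>\<eta>. 0 \<le> \<eta> \<and> \<eta> \<le> 1 \<and> dp_colorable \<eta> G q)"
  define s where "s = Sup {\<eta>. P \<eta>}"
  have P0: "P 0"
    by (auto simp: P_def dp_colorable_def dp_coloring_def independent_set_def intro!: exI[of _ "{}"])
  have bdd: "bdd_above {\<eta>. P \<eta>}" by (auto simp: P_def intro!: bdd_aboveI[of _ 1])
  have upper: "\<eta> \<le> s" if "P \<eta>" for \<eta>
    unfolding s_def using that bdd by (auto intro: cSup_upper)
  have "{\<eta>. P \<eta>} \<noteq> {}" using P0 by blast
  then have s1: "s \<le> 1" unfolding s_def by (rule cSup_least) (simp add: P_def)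
  have "dp_colorable s G q"
    unfolding dp_colorable_def
  proof (intro allI impI)
    fix L and H :: "nat pair_pre_digraph"
    assume cov: "fold_dp_cover q G L H"
    have "\<exists>\<eta>. P \<eta> \<and> real_of_int \<lceil>s * q\<rceil> - 1 < \<eta> * q"
    proof (cases "q = 0")
      case True then show ?thesis using P0 by auto
    next
      case False
      then have "(real_of_int \<lceil>s * q\<rceil> - 1) / q < s"
        by (simp add: divide_less_eq) linarith
      then obtain \<eta> where "P \<eta>" "(real_of_int \<lceil>s * q\<rceil> - 1) / q < \<eta>"
        using less_cSup_iff[OF _ bdd] P0 unfolding s_def by auto
      with False show ?thesis by (auto simp: divide_less_eq)
    qed
    then obtain \<eta> where "P \<eta>" and \<eta>: "real_of_int \<lceil>s * q\<rceil> - 1 < \<eta> * q" by blast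
    with cov obtain S where S: "dp_coloring \<eta> G L H S"
      by (auto simp: P_def dp_colorable_def)
    have "s * real (card (L u)) \<le> real (card (S \<inter> L u))" if u: "u \<in> pverts G" for u
    proof -
      have q: "card (L u) = q" using cov u by (simp add: fold_dp_cover_def)
      have "\<eta> * q \<le> real (card (S \<inter> L u))" using S u q by (auto simp: dp_coloring_def)
      with \<eta> have "real_of_int \<lceil>s * q\<rceil> < real_of_int (int (card (S \<inter> L u)) + 1)" by simp
      then have "\<lceil>s * q\<rceil> \<le> int (card (S \<inter> L u))" by linarith
      then show ?thesis unfolding q by linarith
    qed
    with S show "\<exists>S. dp_coloring s G L H S" by (auto simp: dp_coloring_def)
  qed
  with s1 upper[OF P0] have Ps: "P s" by (simp add: P_def)
  have th: "theta_dp G q = s"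
    unfolding theta_dp_def P_def[symmetric]
    using Ps upper by (intro Greatest_equality) (auto simp: P_def)
  show "0 \<le> theta_dp G q \<and> theta_dp G q \<le> 1 \<and> dp_colorable (theta_dp G q) G q"
    using Ps unfolding th P_def .
  show "0 \<le> \<eta> \<Longrightarrow> \<eta> \<le> 1 \<Longrightarrow> dp_colorable \<eta> G q \<Longrightarrow> \<eta> \<le> theta_dp G q"
    using upper[of \<eta>] unfolding th P_def by blast
qed

end

theory Submission
  imports Defs "HOL-Real_Asymp.Real_Asymp"
begin

text \<open>
  Process the vertices of the cover graph \<open>H\<close> along the degeneracy order. Every vertex \<open>x\<close> starts
  with weight \<open>p\<close>; the weight drops to \<open>0\<close> once an earlier neighbour \<open>w\<close> is selected, and is divided by
  \<open>1 - select w\<close> if \<open>w\<close> is passed over. When its turn comes, \<open>x\<close> is selected with probability equal to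
  its weight, unless that exceeds a cap \<open>\<tau>\<close>, in which case it is discarded. The weight of \<open>x\<close> is a
  martingale, and biasing by it amounts to running the same process with the earlier neighbours of \<open>x\<close>
  never selected. So \<open>x\<close> is selected with probability \<open>p\<close> times the biased probability that the cap is
  respected. In the biased process the weights of earlier neighbours of \<open>x\<close> having few neighbours
  among each other are still almost martingales, and Markov's inequality bounds their sum; the
  remaining ones are rare because the neighbourhood is \<open>K\<^sub>t\<^sub>,\<^sub>t\<close>-free. With \<open>\<tau> = d powr (1 / (3 * t) - 1)\<close>
  and \<open>p = ln d / (6 * t * d)\<close> every vertex of \<open>H\<close> is selected with probability at least
  \<open>ln d / (15 * t * d)\<close>, so the error term \<open>\<epsilon>\<close> can be taken to be \<open>0\<close>.

  Selections of vertices with disjoint sets of ancestors are independent, and each vertex shares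
  ancestors with a number of others bounded in terms of \<open>G\<close> alone. By Chebyshev's inequality, for large
  \<open>q\<close> some outcome meets every list in a fraction of at least \<open>ln d / (16 * t * d)\<close>.
\<close>

section \<open>Sequential random selection\<close>

text \<open>The law of a random subset built by sequential decisions, \<open>r x S\<close> being the
  probability of taking \<open>x\<close>. The final set \<open>S\<close> stands in for the history,
  so each lemma states which elements \<open>r x\<close> must ignore.\<close>

definition seq_weight :: "('b \<Rightarrow> 'b set \<Rightarrow> real) \<Rightarrow> 'b set \<Rightarrow> 'b set \<Rightarrow> real" where
  "seq_weight r V S = (\<Prod>x\<in>V. if x \<in> S then r x S else 1 - r x S)"

lemma sum_Pow_insert:
  fixes f :: "'b set \<Rightarrow> 'c::comm_monoid_add"
  assumes "finite V" "z \<notin> V"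
  shows "(\<Sum>S\<in>Pow (insert z V). f S) = (\<Sum>S\<in>Pow V. f S + f (insert z S))"
proof -
  have "inj_on (insert z) (Pow V)" using assms by (auto simp: inj_on_def)
  then have "(\<Sum>S\<in>insert z ` Pow V. f S) = (\<Sum>S\<in>Pow V. f (insert z S))"
    by (simp add: sum.reindex)
  moreover have "Pow V \<inter> insert z ` Pow V = {}" using assms by auto
  ultimately show ?thesis
    using assms by (simp add: Pow_insert sum.union_disjoint sum.distrib)
qed

lemma seq_weight_nonneg:
  assumes "\<And>x. x \<in> V \<Longrightarrow> 0 \<le> r x S \<and> r x S \<le> 1"
  shows "0 \<le> seq_weight r V S"
  unfolding seq_weight_def using assms by (auto intro!: prod_nonneg)

text \<open>No decision in \<open>insert z V\<close> looks at \<open>z\<close>, so \<open>z\<close>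
  may be decided last: each outcome on \<open>V\<close> splits into two branches of probability
  \<open>r z S\<close> and \<open>1 - r z S\<close>.\<close>

lemma sum_seq_weight_insert:
  assumes "finite V" "z \<notin> V"
    and r: "\<And>x S. x \<in> insert z V \<Longrightarrow> r x (insert z S) = r x S"
  shows "(\<Sum>S\<in>Pow (insert z V). seq_weight r (insert z V) S * f S) =
    (\<Sum>S\<in>Pow V. seq_weight r V S * (r z S * f (insert z S) + (1 - r z S) * f S))"
proof -
  have w: "seq_weight r (insert z V) (insert z S) = r z S * seq_weight r V S"
    "seq_weight r (insert z V) S = (1 - r z S) * seq_weight r V S" if "S \<in> Pow V" for S
  proof -
    have "z \<notin> S" using that assms by auto
    moreover have "(\<Prod>x\<in>V. if x \<in> insert z S then r x (insert z S) else 1 - r x (insert z S)) =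
        (\<Prod>x\<in>V. if x \<in> S then r x S else 1 - r x S)"
      by (rule prod.cong) (use assms in auto)
    ultimately show "seq_weight r (insert z V) (insert z S) = r z S * seq_weight r V S"
      "seq_weight r (insert z V) S = (1 - r z S) * seq_weight r V S"
      using assms by (simp_all add: seq_weight_def)
  qed
  show ?thesis
    unfolding sum_Pow_insert[OF assms(1,2)]
    by (intro sum.cong refl) (simp only: w, simp add: algebra_simps)
qed

text \<open>Elements outside \<open>A\<close> are summed out. They join \<open>A\<close> in order of
  increasing rank, so each new \<open>z\<close> can be decided last, and its two branches carry the
  same value of \<open>f\<close>. Elements of \<open>A\<close> must ignore \<open>z\<close> whatever
  their rank, as they are present from the start.\<close>

lemma sum_seq_weight_marginal:
  fixes \<rho> :: "'b \<Rightarrow> nat"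
  assumes "finite V" "A \<subseteq> V"
    and r: "\<And>x z S. x \<in> V \<Longrightarrow> z \<in> V - A \<Longrightarrow> x \<in> A \<or> \<rho> x \<le> \<rho> z \<Longrightarrow> r x (insert z S) = r x S"
    and f: "\<And>z S. z \<in> V - A \<Longrightarrow> f (insert z S) = f S"
  shows "(\<Sum>S\<in>Pow V. seq_weight r V S * f S) = (\<Sum>S\<in>Pow A. seq_weight r A S * f S)"
proof -
  have "(\<Sum>S\<in>Pow (A \<union> B). seq_weight r (A \<union> B) S * f S) = (\<Sum>S\<in>Pow A. seq_weight r A S * f S)"
    if "finite B" "B \<subseteq> V - A" for B
    using that
  proof (induction B rule: finite_ranking_induct[where f = \<rho>])
    case empty
    then show ?case by simp
  next
    case (insert z B)
    show ?case
    proof (cases "z \<in> B")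
      case True
      then show ?thesis using insert by (simp add: insert_absorb)
    next
      case False
      have z: "z \<notin> A \<union> B" "finite (A \<union> B)"
        using False insert.prems insert.hyps assms finite_subset by auto
      have "r x (insert z S) = r x S" if "x \<in> insert z (A \<union> B)" for x S
        using that insert.prems insert.hyps assms(2) by (intro r) auto
      then have "(\<Sum>S\<in>Pow (insert z (A \<union> B)). seq_weight r (insert z (A \<union> B)) S * f S) =
          (\<Sum>S\<in>Pow (A \<union> B). seq_weight r (A \<union> B) S *
             (r z S * f (insert z S) + (1 - r z S) * f S))"
        using z by (intro sum_seq_weight_insert) auto
      also have "\<dots> = (\<Sum>S\<in>Pow (A \<union> B). seq_weight r (A \<union> B) S * f S)"
        using f[of z] insert.prems by (intro sum.cong) (auto simp: algebra_simps)
      also have "\<dots> = (\<Sum>S\<in>Pow A. seq_weight r A S * f S)"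
        using insert by auto
      finally show ?thesis by simp
    qed
  qed
  from this[of "V - A"] show ?thesis
    using assms(1,2) by (simp add: Un_absorb1)
qed

lemma sum_seq_weight_eq_1:
  fixes \<rho> :: "'b \<Rightarrow> nat"
  assumes "finite V"
    and "\<And>x z S. x \<in> V \<Longrightarrow> z \<in> V \<Longrightarrow> \<rho> x \<le> \<rho> z \<Longrightarrow> r x (insert z S) = r x S"
  shows "(\<Sum>S\<in>Pow V. seq_weight r V S) = 1"
  using sum_seq_weight_marginal[of V "{}" \<rho> r "\<lambda>_. 1"] assms
  by (auto simp: seq_weight_def)

text \<open>Restricting to \<open>v\<close> and the elements ranked below it makes \<open>v\<close>
  the last decision; a second marginalisation leads back to \<open>V\<close>.\<close>

lemma sum_seq_weight_mem:
  fixes \<rho> :: "'b \<Rightarrow> nat"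
  assumes "finite V" "v \<in> V"
    and r: "\<And>x z S. x \<in> V \<Longrightarrow> z \<in> V \<Longrightarrow> \<rho> x \<le> \<rho> z \<Longrightarrow> r x (insert z S) = r x S"
  shows "(\<Sum>S\<in>Pow V. seq_weight r V S * of_bool (v \<in> S)) = (\<Sum>S\<in>Pow V. seq_weight r V S * r v S)"
proof -
  define A where "A = {y \<in> V. \<rho> y < \<rho> v}"
  have A: "v \<notin> A" "finite A" "insert v A \<subseteq> V" "A \<subseteq> V" using assms by (auto simp: A_def)
  have "(\<Sum>S\<in>Pow V. seq_weight r V S * of_bool (v \<in> S)) =
      (\<Sum>S\<in>Pow (insert v A). seq_weight r (insert v A) S * of_bool (v \<in> S))"
    using assms A by (intro sum_seq_weight_marginal[where \<rho> = \<rho>] r) (auto simp: A_def)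
  also have "\<dots> = (\<Sum>S\<in>Pow A. seq_weight r A S *
      (r v S * of_bool (v \<in> insert v S) + (1 - r v S) * of_bool (v \<in> S)))"
    using A by (intro sum_seq_weight_insert r) (auto simp: A_def)
  also have "\<dots> = (\<Sum>S\<in>Pow A. seq_weight r A S * r v S)"
    using A by (intro sum.cong) auto
  also have "\<dots> = (\<Sum>S\<in>Pow V. seq_weight r V S * r v S)"
    using assms A by (intro sum_seq_weight_marginal[where \<rho> = \<rho>, symmetric] r) (auto simp: A_def)
  finally show ?thesis .
qed

text \<open>Independence: decisions in \<open>A\<close> look only at \<open>A\<close>, those in
  \<open>B\<close> only at \<open>B\<close>, so the weight factorises along
  \<open>S \<mapsto> (S \<inter> A, S \<inter> B)\<close>.\<close>

lemma sum_seq_weight_product: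
  assumes "finite A" "finite B" "A \<inter> B = {}"
    and r: "\<And>x S. x \<in> A \<Longrightarrow> r x (S \<inter> A) = r x S" "\<And>x S. x \<in> B \<Longrightarrow> r x (S \<inter> B) = r x S"
    and f: "\<And>S. f (S \<inter> A) = f S" and g: "\<And>S. g (S \<inter> B) = g S"
  shows "(\<Sum>S\<in>Pow (A \<union> B). seq_weight r (A \<union> B) S * (f S * g S)) =
    (\<Sum>S\<in>Pow A. seq_weight r A S * f S) * (\<Sum>S\<in>Pow B. seq_weight r B S * g S)"
proof -
  let ?j = "\<lambda>(S, T). S \<union> T"
  have bij: "bij_betw ?j (Pow A \<times> Pow B) (Pow (A \<union> B))"
    using assms(3) by (intro bij_betw_byWitness[where f' = "\<lambda>S. (S \<inter> A, S \<inter> B)"]) auto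
  have w: "seq_weight r (A \<union> B) (S \<union> T) * (f (S \<union> T) * g (S \<union> T)) =
      (seq_weight r A S * f S) * (seq_weight r B T * g T)" if "S \<subseteq> A" "T \<subseteq> B" for S T
  proof -
    have S: "(S \<union> T) \<inter> A = S" "(S \<union> T) \<inter> B = T" using that assms(3) by auto
    have "r x (S \<union> T) = r x S" if "x \<in> A" for x using r(1)[OF that, of "S \<union> T"] S by simp
    then have 1: "seq_weight r A (S \<union> T) = seq_weight r A S"
      unfolding seq_weight_def using S by (intro prod.cong) auto
    have "r x (S \<union> T) = r x T" if "x \<in> B" for x using r(2)[OF that, of "S \<union> T"] S by simp
    then have 2: "seq_weight r B (S \<union> T) = seq_weight r B T"
      unfolding seq_weight_def using S by (intro prod.cong) auto
    have "seq_weight r (A \<union> B) (S \<union> T) = seq_weight r A (S \<union> T) * seq_weight r B (S \<union> T)"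
      unfolding seq_weight_def using assms by (intro prod.union_disjoint)
    with 1 2 show ?thesis using f[of "S \<union> T"] g[of "S \<union> T"] S by simp
  qed
  have "(\<Sum>S\<in>Pow (A \<union> B). seq_weight r (A \<union> B) S * (f S * g S)) =
      (\<Sum>(S, T)\<in>Pow A \<times> Pow B. (seq_weight r A S * f S) * (seq_weight r B T * g T))"
    using w by (subst sum.reindex_bij_betw[OF bij, symmetric]) (auto intro!: sum.cong)
  also have "\<dots> = (\<Sum>S\<in>Pow A. seq_weight r A S * f S) * (\<Sum>S\<in>Pow B. seq_weight r B S * g S)"
    by (simp add: sum_product sum.cartesian_product)
  finally show ?thesis .
qed

section \<open>The capped greedy process\<close>

locale greedy_process =
  fixes V :: "'b set" and N :: "'b \<Rightarrow> 'b set" and \<rho> :: "'b \<Rightarrow> nat" and p \<tau> :: real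
  assumes finite_V: "finite V"
    and N_subset: "x \<in> V \<Longrightarrow> N x \<subseteq> V"
    and N_rank: "y \<in> N x \<Longrightarrow> \<rho> y < \<rho> x"
    and p_pos: "0 < p" and \<tau>_nonneg: "0 \<le> \<tau>" and \<tau>_less_1: "\<tau> < 1"
begin

text \<open>The recursion ends because ranks drop along \<open>N\<close>. The cap keeps every value
  at most \<open>\<tau> < 1\<close>, so no denominator vanishes.\<close>

function select :: "'b \<Rightarrow> 'b set \<Rightarrow> real" where
  "select x S =
    (if p * (\<Prod>w\<in>N x. if w \<in> S then 0 else 1 / (1 - select w S)) \<le> \<tau>
     then p * (\<Prod>w\<in>N x. if w \<in> S then 0 else 1 / (1 - select w S)) else 0)"
  by pat_completeness auto
termination
  by (relation "Wellfounded.measure (\<lambda>(x, S). \<rho> x)") (auto simp: N_rank)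

declare select.simps [simp del]

definition avoid :: "'b set \<Rightarrow> 'b set \<Rightarrow> real" where
  "avoid W S = (\<Prod>w\<in>W. if w \<in> S then 0 else 1 / (1 - select w S))"

lemma select_eq: "select x S = (if p * avoid (N x) S \<le> \<tau> then p * avoid (N x) S else 0)"
  unfolding avoid_def by (rule select.simps)

lemma select_le: "select x S \<le> \<tau>"
  using \<tau>_nonneg by (simp add: select_eq)

lemma select_less_1: "select x S < 1"
  using select_le \<tau>_less_1 by (rule order.strict_trans1)

lemma avoid_factor_nonneg: "0 \<le> (if w \<in> S then 0 else 1 / (1 - select w S))"
  using select_less_1[of w S] by simp

lemma avoid_nonneg: "0 \<le> avoid W S"
  unfolding avoid_def by (intro prod_nonneg ballI avoid_factor_nonneg)

lemma select_nonneg: "0 \<le> select x S"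
  using p_pos avoid_nonneg by (simp add: select_eq)

lemma select_le_avoid: "select x S \<le> p * avoid (N x) S"
  using p_pos avoid_nonneg[of "N x" S] by (simp add: select_eq)

text \<open>By induction on rank: only membership of, and decisions at, vertices reached through
  \<open>N\<close> matter, and these stay in \<open>A\<close>. Asking for
  \<open>N x \<subseteq> A\<close> instead of \<open>x \<in> A\<close> lets \<open>A\<close> be the
  set of all vertices of rank below some bound that \<open>x\<close> itself attains.\<close>

lemma select_cong:
  assumes "\<And>y. y \<in> A \<Longrightarrow> N y \<subseteq> A" "N x \<subseteq> A" "S \<inter> A = T \<inter> A"
  shows "select x S = select x T"
  using assms(2)
proof (induction "\<rho> x" arbitrary: x rule: less_induct)
  case less
  have "select w S = select w T" if "w \<in> N x" for w
    using that less.prems assms(1) N_rank by (intro less.hyps) auto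
  moreover have "w \<in> S \<longleftrightarrow> w \<in> T" if "w \<in> N x" for w
    using that less.prems assms(3) by blast
  ultimately have "avoid (N x) S = avoid (N x) T"
    unfolding avoid_def by (intro prod.cong) auto
  then show ?case by (simp add: select_eq)
qed

lemma select_insert: "\<rho> x \<le> \<rho> z \<Longrightarrow> select x (insert z S) = select x S"
proof (rule select_cong[where A = "{y. \<rho> y < \<rho> z}"])
  fix y assume "y \<in> {y. \<rho> y < \<rho> z}"
  then show "N y \<subseteq> {y. \<rho> y < \<rho> z}" using N_rank order.strict_trans by blast
next
  assume "\<rho> x \<le> \<rho> z"
  then show "N x \<subseteq> {y. \<rho> y < \<rho> z}" using N_rank order.strict_trans2 by blast
qed auto

text \<open>Only the outermost probability is set to \<open>0\<close>. Inside \<open>select\<close>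
  the divisions by \<open>1 - select w S\<close> remain for forbidden \<open>w\<close>, which is why
  weights can drift upwards in the biased process.\<close>

definition forbid :: "'b set \<Rightarrow> 'b \<Rightarrow> 'b set \<Rightarrow> real" where
  "forbid Z x S = (if x \<in> Z then 0 else select x S)"

lemma forbid_empty [simp]: "forbid {} = select"
  by (simp add: forbid_def fun_eq_iff)

lemma sum_forbid: "(\<Sum>S\<in>Pow V. seq_weight (forbid Z) V S) = 1"
  by (rule sum_seq_weight_eq_1[where \<rho> = \<rho>]) (auto simp: finite_V forbid_def select_insert)

lemma forbid_weight_nonneg: "0 \<le> seq_weight (forbid Z) V S"
  using select_nonneg select_less_1
  by (intro seq_weight_nonneg) (auto simp: forbid_def intro: less_imp_le)

text \<open>Reweighting by \<^term>\<open>avoid W\<close> is conditioning the process step by step on never selecting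
  a vertex of \<^term>\<open>W\<close>.\<close>

lemma forbid_avoid:
  assumes "W \<subseteq> V" "W \<inter> Z = {}"
  shows "seq_weight (forbid Z) V S * avoid W S = seq_weight (forbid (Z \<union> W)) V S"
proof -
  have "avoid W S = (\<Prod>w\<in>V. if w \<in> W then if w \<in> S then 0 else 1 / (1 - select w S) else 1)"
    unfolding avoid_def prod.inter_restrict[OF finite_V, symmetric] using assms(1)
    by (simp add: Int_absorb1)
  moreover have "select x S \<noteq> 1" for x using select_less_1[of x S] by simp
  ultimately show ?thesis
    unfolding seq_weight_def using assms(2)
    by (auto simp: prod.distrib[symmetric] forbid_def intro!: prod.cong)
qed

text \<open>Given the earlier choices, \<open>x\<close> is taken with probability
  \<open>p * avoid (N x) S\<close> if the cap allows it; the factor \<open>avoid (N x) S\<close> is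
  absorbed by the change of law in \<open>forbid_avoid\<close>.\<close>

lemma prob_mem_eq:
  assumes "x \<in> V"
  shows "(\<Sum>S\<in>Pow V. seq_weight select V S * of_bool (x \<in> S)) =
    p * (\<Sum>S\<in>Pow V. seq_weight (forbid (N x)) V S * of_bool (p * avoid (N x) S \<le> \<tau>))"
proof -
  have "(\<Sum>S\<in>Pow V. seq_weight select V S * of_bool (x \<in> S)) =
      (\<Sum>S\<in>Pow V. seq_weight select V S * select x S)"
    using finite_V assms by (intro sum_seq_weight_mem[where \<rho> = \<rho>] select_insert)
  also have "\<dots> = (\<Sum>S\<in>Pow V. p * (seq_weight (forbid (N x)) V S * of_bool (p * avoid (N x) S \<le> \<tau>)))"
    using forbid_avoid[OF N_subset[OF assms], of "{}"]
    by (intro sum.cong) (auto simp: select_eq)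
  finally show ?thesis by (simp add: sum_distrib_left)
qed

text \<open>The weight of \<open>u\<close> can drift only at its at most \<open>D\<close> neighbours
  in \<open>Z\<close>, each costing a factor of at most \<open>1 / (1 - \<tau>)\<close>. The
  remaining factor \<open>avoid (N u - Z) S\<close> turns the law into that of another biased
  process, of total mass 1.\<close>

lemma sum_forbid_select_le:
  assumes u: "u \<in> V" and D: "card (N u \<inter> Z) \<le> D"
  shows "(\<Sum>S\<in>Pow V. seq_weight (forbid Z) V S * select u S) \<le> p * (1 / (1 - \<tau>)) ^ D"
proof -
  let ?c = "(1 / (1 - \<tau>)) ^ D"
  have fin: "finite (N u)" using finite_subset[OF N_subset[OF u] finite_V] .
  have "select u S \<le> p * ?c * avoid (N u - Z) S" for S
  proof -
    have "avoid (N u) S = avoid (N u \<inter> Z) S * avoid (N u - Z) S"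
      unfolding avoid_def using fin by (subst prod.union_disjoint[symmetric]) (auto intro: prod.cong)
    moreover have "avoid (N u \<inter> Z) S \<le> (\<Prod>w\<in>N u \<inter> Z. 1 / (1 - \<tau>))"
      unfolding avoid_def using select_le select_less_1 \<tau>_less_1 avoid_factor_nonneg
      by (intro prod_mono) (auto intro!: divide_left_mono mult_pos_pos)
    moreover have "(1 / (1 - \<tau>)) ^ card (N u \<inter> Z) \<le> ?c"
      using D \<tau>_nonneg \<tau>_less_1 by (intro power_increasing) auto
    ultimately have "avoid (N u) S \<le> ?c * avoid (N u - Z) S"
      using avoid_nonneg[of "N u - Z" S] by (simp add: mult_right_mono)
    then have "p * avoid (N u) S \<le> p * (?c * avoid (N u - Z) S)"
      using p_pos by simp
    with select_le_avoid[of u S] show ?thesis by (simp add: mult.assoc)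
  qed
  then have "seq_weight (forbid Z) V S * select u S \<le>
      p * ?c * seq_weight (forbid (Z \<union> (N u - Z))) V S" for S
    using mult_left_mono[OF _ forbid_weight_nonneg[of Z S], of "select u S" "p * ?c * avoid (N u - Z) S"]
      forbid_avoid[of "N u - Z" Z S] N_subset[OF u]
    by (metis Diff_disjoint Diff_subset inf_commute mult.left_commute subset_trans)
  then have "(\<Sum>S\<in>Pow V. seq_weight (forbid Z) V S * select u S) \<le>
      (\<Sum>S\<in>Pow V. p * ?c * seq_weight (forbid (Z \<union> (N u - Z))) V S)"
    by (rule sum_mono)
  also have "\<dots> = p * ?c" by (simp only: sum_distrib_left[symmetric] sum_forbid)
  finally show ?thesis .
qed

text \<open>For \<open>0 \<le> s \<le> \<tau>\<close>,
  \<open>1 / (1 - s) \<le> exp (s / (1 - \<tau>))\<close>. This reduces the cap condition to a bound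
  on a sum, to which Markov's inequality applies.\<close>

lemma avoid_le_exp:
  assumes "finite W"
  shows "avoid W S \<le> exp ((\<Sum>w\<in>W. select w S) / (1 - \<tau>))"
proof -
  have "(if w \<in> S then 0 else 1 / (1 - select w S)) \<le> exp (select w S / (1 - \<tau>))" for w
  proof -
    have s: "0 \<le> select w S" "select w S \<le> \<tau>" "select w S < 1"
      using select_nonneg select_le[of w S] \<tau>_less_1 by auto
    have "1 / (1 - select w S) = 1 + select w S / (1 - select w S)"
      using s by (simp add: field_simps)
    also have "\<dots> \<le> 1 + select w S / (1 - \<tau>)"
      using s \<tau>_less_1 by (intro add_left_mono divide_left_mono mult_pos_pos) auto
    also have "\<dots> \<le> exp (select w S / (1 - \<tau>))" by (rule exp_ge_add_one_self)
    finally show ?thesis using less_imp_le[OF exp_gt_zero] by auto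
  qed
  then have "avoid W S \<le> (\<Prod>w\<in>W. exp (select w S / (1 - \<tau>)))"
    unfolding avoid_def by (intro prod_mono conjI avoid_factor_nonneg)
  then show ?thesis using assms by (simp add: exp_sum sum_divide_distrib)
qed

text \<open>The vertices of \<^term>\<open>B\<close> are the exceptional ones, with many neighbours inside
  \<^term>\<open>N x\<close>; only the cap \<^term>\<open>\<tau>\<close> is used for them. The others are treated by Markov's
  inequality.\<close>

lemma prob_mem_ge:
  fixes \<mu> b :: real
  assumes x: "x \<in> V" and d: "card (N x) \<le> d" and B: "B \<subseteq> N x" "real (card B) \<le> b"
    and D: "\<And>u. u \<in> N x - B \<Longrightarrow> card (N u \<inter> N x) \<le> D"
    and \<mu>: "0 < \<mu>" "p * exp ((\<mu> + b * \<tau>) / (1 - \<tau>)) \<le> \<tau>"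
  shows "p * (1 - real d * p * (1 / (1 - \<tau>)) ^ D / \<mu>) \<le>
    (\<Sum>S\<in>Pow V. seq_weight select V S * of_bool (x \<in> S))"
proof -
  let ?Q = "\<lambda>S. seq_weight (forbid (N x)) V S"
  let ?c = "p * (1 / (1 - \<tau>)) ^ D"
  define X where "X S = (\<Sum>u\<in>N x - B. select u S)" for S
  have fin: "finite (N x)" using finite_subset[OF N_subset[OF x] finite_V] .
  then have finB: "finite B" using B finite_subset by blast
  have c: "0 \<le> ?c" using p_pos \<tau>_less_1 by simp
  have X0: "0 \<le> X S" for S unfolding X_def by (intro sum_nonneg select_nonneg)
  have "(\<Sum>S\<in>Pow V. ?Q S * X S) = (\<Sum>u\<in>N x - B. \<Sum>S\<in>Pow V. ?Q S * select u S)"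
    unfolding X_def sum_distrib_left by (rule sum.swap)
  also have "\<dots> \<le> (\<Sum>u\<in>N x - B. ?c)"
    using D N_subset[OF x] by (intro sum_mono sum_forbid_select_le) auto
  also have "\<dots> = real (card (N x - B)) * ?c" by simp
  also have "\<dots> \<le> real d * ?c"
  proof (intro mult_right_mono c)
    show "real (card (N x - B)) \<le> real d"
      using card_mono[OF fin, of "N x - B"] d by auto
  qed
  finally have EX: "(\<Sum>S\<in>Pow V. ?Q S * X S) \<le> real d * ?c" .
  \<comment> \<open>Markov's inequality in pointwise form: if \<open>X S \<le> \<mu>\<close> the cap
    is respected and the indicator is 1; otherwise \<open>1 - X S / \<mu>\<close> is not
    positive.\<close>
  have pt: "?Q S * (1 - X S / \<mu>) \<le> ?Q S * of_bool (p * avoid (N x) S \<le> \<tau>)" for S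
  proof (intro mult_left_mono forbid_weight_nonneg)
    show "1 - X S / \<mu> \<le> of_bool (p * avoid (N x) S \<le> \<tau>)"
    proof (cases "X S \<le> \<mu>")
      case True
      have "(\<Sum>u\<in>B. select u S) \<le> (\<Sum>u\<in>B. \<tau>)" by (intro sum_mono select_le)
      also have "\<dots> \<le> b * \<tau>" using B \<tau>_nonneg by (simp add: mult_right_mono)
      finally have "(\<Sum>u\<in>N x. select u S) \<le> \<mu> + b * \<tau>"
        using True sum.subset_diff[OF B(1) fin, of "\<lambda>u. select u S"] by (simp add: X_def)
      then have "(\<Sum>u\<in>N x. select u S) / (1 - \<tau>) \<le> (\<mu> + b * \<tau>) / (1 - \<tau>)"
        using \<tau>_less_1 by (intro divide_right_mono) auto
      then have "avoid (N x) S \<le> exp ((\<mu> + b * \<tau>) / (1 - \<tau>))"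
        using avoid_le_exp[OF fin, of S] by (meson exp_le_cancel_iff order.trans)
      then have "p * avoid (N x) S \<le> p * exp ((\<mu> + b * \<tau>) / (1 - \<tau>))"
        using p_pos by simp
      with \<mu> have "p * avoid (N x) S \<le> \<tau>" by linarith
      then show ?thesis using X0[of S] \<mu> by simp
    next
      case False
      then have "1 \<le> X S / \<mu>" using \<mu> by simp
      then show ?thesis by (simp add: of_bool_def)
    qed
  qed
  have "1 - real d * ?c / \<mu> \<le> (\<Sum>S\<in>Pow V. ?Q S) - (\<Sum>S\<in>Pow V. ?Q S * X S) / \<mu>"
    using EX \<mu> by (simp add: sum_forbid divide_right_mono)
  also have "\<dots> = (\<Sum>S\<in>Pow V. ?Q S * (1 - X S / \<mu>))"
    by (simp add: right_diff_distrib sum_subtractf sum_divide_distrib)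
  also have "\<dots> \<le> (\<Sum>S\<in>Pow V. ?Q S * of_bool (p * avoid (N x) S \<le> \<tau>))"
    by (intro sum_mono pt)
  finally have "p * (1 - real d * ?c / \<mu>) \<le>
      p * (\<Sum>S\<in>Pow V. ?Q S * of_bool (p * avoid (N x) S \<le> \<tau>))"
    using p_pos by simp
  then show ?thesis unfolding prob_mem_eq[OF x] by (simp add: mult.assoc)
qed

subsection \<open>Independence and concentration\<close>

definition expect :: "('b set \<Rightarrow> real) \<Rightarrow> real" where
  "expect f = (\<Sum>S\<in>Pow V. seq_weight select V S * f S)"

abbreviation prob_mem :: "'b \<Rightarrow> real" where
  "prob_mem x \<equiv> expect (\<lambda>S. of_bool (x \<in> S))"

lemma weight_nonneg: "0 \<le> seq_weight select V S"
  using forbid_weight_nonneg[of "{}"] by simp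

lemma expect_const: "expect (\<lambda>_. c) = c"
  using sum_forbid[of "{}"] by (simp add: expect_def sum_distrib_right[symmetric])

lemma expect_mono: "(\<And>S. S \<subseteq> V \<Longrightarrow> f S \<le> g S) \<Longrightarrow> expect f \<le> expect g"
  unfolding expect_def by (intro sum_mono mult_left_mono weight_nonneg) auto

lemma expect_add: "expect (\<lambda>S. f S + g S) = expect f + expect g"
  by (simp add: expect_def distrib_left sum.distrib)

lemma expect_cmult: "expect (\<lambda>S. c * f S) = c * expect f"
  by (simp add: expect_def sum_distrib_left mult.left_commute)

lemma expect_sum: "expect (\<lambda>S. \<Sum>i\<in>I. f i S) = (\<Sum>i\<in>I. expect (f i))"
  unfolding expect_def sum_distrib_left by (rule sum.swap)

text \<open>The closure is reflexive, so that the event \<open>x \<in> S\<close> is determined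
  within this set.\<close>

definition ancestors :: "'b \<Rightarrow> 'b set" where
  "ancestors x = {(a, b). b \<in> N a}\<^sup>* `` {x}"

lemma ancestors_self: "x \<in> ancestors x"
  by (simp add: ancestors_def)

lemma ancestors_closed: "y \<in> ancestors x \<Longrightarrow> N y \<subseteq> ancestors x"
  by (auto simp: ancestors_def intro: rtrancl_into_rtrancl)

lemma ancestors_subset:
  assumes "x \<in> V" shows "ancestors x \<subseteq> V"
proof
  fix y assume "y \<in> ancestors x"
  then have "(x, y) \<in> {(a, b). b \<in> N a}\<^sup>*" by (simp add: ancestors_def)
  then show "y \<in> V" by induction (use assms N_subset in auto)
qed

text \<open>Vertices outside a set closed under \<open>N\<close> can be summed out: decisions inside
  never consult them, and among themselves they are ordered by rank.\<close>

lemma expect_closed: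
  assumes "A \<subseteq> V" "\<And>x. x \<in> A \<Longrightarrow> N x \<subseteq> A" "\<And>S. f (S \<inter> A) = f S"
  shows "expect f = (\<Sum>S\<in>Pow A. seq_weight select A S * f S)"
  unfolding expect_def
proof (rule sum_seq_weight_marginal[where \<rho> = \<rho>])
  fix x z S assume z: "z \<in> V - A" and xz: "x \<in> A \<or> \<rho> x \<le> \<rho> z"
  from xz show "select x (insert z S) = select x S"
  proof
    assume "x \<in> A"
    then show ?thesis using assms z by (intro select_cong[where A = A]) auto
  qed (rule select_insert)
next
  fix z S assume "z \<in> V - A"
  then have "insert z S \<inter> A = S \<inter> A" by auto
  then show "f (insert z S) = f S" using assms(3) by metis
qed (use assms finite_V in auto)

lemma expect_indep:
  assumes xy: "x \<in> V" "y \<in> V" and dis: "ancestors x \<inter> ancestors y = {}"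
  shows "expect (\<lambda>S. of_bool (x \<in> S) * of_bool (y \<in> S)) = prob_mem x * prob_mem y"
proof -
  let ?A = "ancestors x" and ?B = "ancestors y"
  have sub: "?A \<subseteq> V" "?B \<subseteq> V" using xy ancestors_subset by auto
  have "expect (\<lambda>S. of_bool (x \<in> S) * of_bool (y \<in> S)) = (\<Sum>S\<in>Pow (?A \<union> ?B).
      seq_weight select (?A \<union> ?B) S * (of_bool (x \<in> S) * of_bool (y \<in> S)))"
  proof (rule expect_closed)
    show "N z \<subseteq> ?A \<union> ?B" if "z \<in> ?A \<union> ?B" for z
      using that ancestors_closed[of z x] ancestors_closed[of z y] by blast
  qed (use sub ancestors_self in auto)
  also have "\<dots> = (\<Sum>S\<in>Pow ?A. seq_weight select ?A S * of_bool (x \<in> S)) *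
      (\<Sum>S\<in>Pow ?B. seq_weight select ?B S * of_bool (y \<in> S))"
  proof (rule sum_seq_weight_product)
    show "finite ?A" "finite ?B" using sub finite_V finite_subset by auto
    show "select z (S \<inter> ?A) = select z S" if "z \<in> ?A" for z S
      using that ancestors_closed by (intro select_cong[where A = ?A]) auto
    show "select z (S \<inter> ?B) = select z S" if "z \<in> ?B" for z S
      using that ancestors_closed by (intro select_cong[where A = ?B]) auto
  qed (use dis ancestors_self in \<open>auto simp: of_bool_def\<close>)
  also have "\<dots> = prob_mem x * prob_mem y"
    using sub ancestors_closed ancestors_self
    by (intro arg_cong2[where f = "(*)"] expect_closed[symmetric]) (auto simp: of_bool_def)
  finally show ?thesis .
qed

lemma prob_mem_bounds: "0 \<le> prob_mem x" "prob_mem x \<le> 1"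
  using expect_mono[of "\<lambda>_. 0" "\<lambda>S. of_bool (x \<in> S)"]
    expect_mono[of "\<lambda>S. of_bool (x \<in> S)" "\<lambda>_. 1"] by (auto simp: expect_const)

text \<open>The covariance vanishes for disjoint ancestor sets by independence; otherwise the
  expected product is at most 1 and the subtracted product of probabilities is nonnegative.\<close>

lemma covariance_le:
  assumes "x \<in> V" "y \<in> V"
  shows "expect (\<lambda>S. (of_bool (x \<in> S) - prob_mem x) * (of_bool (y \<in> S) - prob_mem y)) \<le>
    of_bool (ancestors x \<inter> ancestors y \<noteq> {})"
proof -
  let ?P = "expect (\<lambda>S. of_bool (x \<in> S) * of_bool (y \<in> S))"
  have "(of_bool (x \<in> S) - prob_mem x) * (of_bool (y \<in> S) - prob_mem y) =
      of_bool (x \<in> S) * of_bool (y \<in> S) + ((- prob_mem y) * of_bool (x \<in> S) +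
      ((- prob_mem x) * of_bool (y \<in> S) + prob_mem x * prob_mem y))" for S
    by (simp add: algebra_simps)
  then have "expect (\<lambda>S. (of_bool (x \<in> S) - prob_mem x) * (of_bool (y \<in> S) - prob_mem y)) =
      ?P - prob_mem x * prob_mem y"
    by (simp only: expect_add expect_cmult expect_const) simp
  moreover have "?P \<le> 1"
    using expect_mono[of "\<lambda>S. of_bool (x \<in> S) * of_bool (y \<in> S)" "\<lambda>_. 1"]
    by (auto simp: expect_const)
  moreover have "0 \<le> prob_mem x * prob_mem y"
    using prob_mem_bounds by simp
  ultimately show ?thesis
    using expect_indep[OF assms] by (cases "ancestors x \<inter> ancestors y = {}") auto
qed

lemma variance_le:
  assumes L: "L \<subseteq> V" and K: "\<And>x. x \<in> L \<Longrightarrow> card {y \<in> L. ancestors x \<inter> ancestors y \<noteq> {}} \<le> K"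
  shows "expect (\<lambda>S. (real (card (S \<inter> L)) - (\<Sum>x\<in>L. prob_mem x))\<^sup>2) \<le> real (card L) * real K"
proof -
  have fin: "finite L" using finite_subset[OF L finite_V] .
  have "real (card (S \<inter> L)) = (\<Sum>x\<in>L. of_bool (x \<in> S))" for S
    using fin by (simp add: of_bool_def sum.If_cases Int_commute)
  then have "(real (card (S \<inter> L)) - (\<Sum>x\<in>L. prob_mem x))\<^sup>2 =
      (\<Sum>x\<in>L. \<Sum>y\<in>L. (of_bool (x \<in> S) - prob_mem x) * (of_bool (y \<in> S) - prob_mem y))" for S
    by (simp add: power2_eq_square sum_subtractf[symmetric] sum_product)
  then have "expect (\<lambda>S. (real (card (S \<inter> L)) - (\<Sum>x\<in>L. prob_mem x))\<^sup>2) =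
      (\<Sum>x\<in>L. \<Sum>y\<in>L. expect (\<lambda>S. (of_bool (x \<in> S) - prob_mem x) * (of_bool (y \<in> S) - prob_mem y)))"
    by (simp add: expect_sum)
  also have "\<dots> \<le> (\<Sum>x\<in>L. \<Sum>y\<in>L. of_bool (ancestors x \<inter> ancestors y \<noteq> {}))"
    using L by (intro sum_mono covariance_le) auto
  also have "\<dots> = (\<Sum>x\<in>L. real (card {y \<in> L. ancestors x \<inter> ancestors y \<noteq> {}}))"
    using fin by (simp add: of_bool_def sum.If_cases Int_def)
  also have "\<dots> \<le> (\<Sum>x\<in>L. real K)" using K by (intro sum_mono) simp
  finally show ?thesis by simp
qed

text \<open>Chebyshev's inequality and the union bound in one step: if every outcome of nonzero
  weight failed on some list, the squared deviations summed over \<open>I\<close> would have mean at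
  least \<open>((\<eta>' - \<eta>) * q)\<^sup>2\<close>, against the variance bound
  \<open>card I * q * K\<close>. Nonzero weight is kept in the conclusion because it forces
  independence in the cover graph.\<close>

lemma exists_concentrated:
  fixes \<eta> \<eta>' :: real
  assumes "finite I" and L: "\<And>i. i \<in> I \<Longrightarrow> L i \<subseteq> V" "\<And>i. i \<in> I \<Longrightarrow> card (L i) = q"
    and K: "\<And>i x. i \<in> I \<Longrightarrow> x \<in> L i \<Longrightarrow> card {y \<in> L i. ancestors x \<inter> ancestors y \<noteq> {}} \<le> K"
    and prob: "\<And>x. x \<in> V \<Longrightarrow> \<eta>' \<le> prob_mem x" and \<eta>: "\<eta> < \<eta>'"
    and q: "real (card I) * real K < (\<eta>' - \<eta>)\<^sup>2 * real q" "0 < q"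
  shows "\<exists>S\<subseteq>V. seq_weight select V S \<noteq> 0 \<and> (\<forall>i\<in>I. \<eta> * real q \<le> real (card (S \<inter> L i)))"
proof (rule ccontr)
  assume neg: "\<not> ?thesis"
  define X where "X i S = (real (card (S \<inter> L i)) - (\<Sum>x\<in>L i. prob_mem x))\<^sup>2" for i S
  let ?c = "((\<eta>' - \<eta>) * real q)\<^sup>2"
  have "seq_weight select V S * ?c \<le> seq_weight select V S * (\<Sum>i\<in>I. X i S)" if S: "S \<subseteq> V" for S
  proof (cases "seq_weight select V S = 0")
    case False
    with neg S obtain i where i: "i \<in> I" "real (card (S \<inter> L i)) < \<eta> * real q"
      by (auto simp: not_le)
    have "(\<Sum>x\<in>L i. \<eta>') \<le> (\<Sum>x\<in>L i. prob_mem x)"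
      using L i(1) by (intro sum_mono prob) auto
    then have "(\<eta>' - \<eta>) * real q \<le> (\<Sum>x\<in>L i. prob_mem x) - real (card (S \<inter> L i))"
      using i L by (simp add: algebra_simps)
    then have "?c \<le> ((\<Sum>x\<in>L i. prob_mem x) - real (card (S \<inter> L i)))\<^sup>2"
      using \<eta> by (intro power_mono) auto
    then have "?c \<le> X i S" by (simp add: X_def power2_commute)
    also have "\<dots> \<le> (\<Sum>i\<in>I. X i S)"
      using i assms(1) by (intro member_le_sum) (auto simp: X_def)
    finally show ?thesis by (intro mult_left_mono weight_nonneg)
  qed simp
  then have "expect (\<lambda>_. ?c) \<le> expect (\<lambda>S. \<Sum>i\<in>I. X i S)"
    unfolding expect_def by (intro sum_mono) auto
  then have "?c \<le> (\<Sum>i\<in>I. expect (X i))" unfolding expect_const expect_sum .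
  also have "\<dots> \<le> (\<Sum>i\<in>I. real q * real K)"
  proof (rule sum_mono)
    fix i assume i: "i \<in> I"
    show "expect (X i) \<le> real q * real K"
      unfolding X_def using variance_le[OF L(1)[OF i] K[OF i]] L(2)[OF i] by simp
  qed
  finally have "real q * ((\<eta>' - \<eta>)\<^sup>2 * real q) \<le> real q * (real (card I) * real K)"
    by (simp add: power2_eq_square algebra_simps)
  with q show False by simp
qed

lemma support_independent:
  assumes "S \<subseteq> V" "seq_weight select V S \<noteq> 0" "x \<in> S" "y \<in> N x"
  shows "y \<notin> S"
proof
  assume "y \<in> S"
  have x: "x \<in> V" using assms by auto
  have "finite (N x)" using finite_subset[OF N_subset[OF x] finite_V] .
  then have "avoid (N x) S = 0"
    unfolding avoid_def using assms(4) \<open>y \<in> S\<close> by (intro prod_zero) auto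
  then have "select x S = 0" by (simp add: select_eq)
  then have "seq_weight select V S = 0"
    unfolding seq_weight_def using x assms(3) finite_V by (intro prod_zero) auto
  with assms(2) show False ..
qed

end

lemma card_relpow_Image_le:
  fixes R :: "('b \<times> 'b) set"
  assumes "\<And>x. finite (R `` {x}) \<and> card (R `` {x}) \<le> m"
  shows "finite ((R ^^ k) `` {x}) \<and> card ((R ^^ k) `` {x}) \<le> m ^ k"
proof (induction k)
  case (Suc k)
  have eq: "(R ^^ Suc k) `` {x} = (\<Union>y\<in>(R ^^ k) `` {x}. R `` {y})" by auto
  have "card ((R ^^ Suc k) `` {x}) \<le> (\<Sum>y\<in>(R ^^ k) `` {x}. card (R `` {y}))"
    unfolding eq using Suc by (intro card_UN_le) auto
  also have "\<dots> \<le> card ((R ^^ k) `` {x}) * m"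
    using assms sum_bounded_above[of "(R ^^ k) `` {x}" "\<lambda>y. card (R `` {y})" m] by auto
  also have "\<dots> \<le> m ^ Suc k" using Suc by simp
  finally show ?case unfolding eq using Suc assms by auto
qed simp

context greedy_process
begin

text \<open>Ranks drop along \<open>N\<close>, so an ancestor is at most \<open>n\<close> steps
  away, and reflexivity of \<open>R\<close> pads the path to exactly \<open>n\<close>. Two vertices
  with a common ancestor are thus joined by \<open>n + n\<close> steps of \<open>R\<close>.\<close>

lemma card_dependent_le:
  fixes R :: "('b \<times> 'b) set"
  assumes R: "sym R" "refl R" "\<And>x. finite (R `` {x}) \<and> card (R `` {x}) \<le> m"
    and N: "\<And>x y. y \<in> N x \<Longrightarrow> (x, y) \<in> R" and n: "\<And>x. x \<in> V \<Longrightarrow> \<rho> x \<le> n"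
    and x: "x \<in> V" and L: "L \<subseteq> V"
  shows "card {y \<in> L. ancestors x \<inter> ancestors y \<noteq> {}} \<le> m ^ (n + n)"
proof -
  have "(a, b) \<in> R ^^ k" if "(a, b) \<in> {(a, b). b \<in> N a}\<^sup>*" "\<rho> a \<le> k" for a b k
    using that
  proof (induction arbitrary: k rule: converse_rtrancl_induct)
    case base
    show ?case using R(2) by (induction k) (auto simp: refl_on_def)
  next
    case (step y z)
    then have "\<rho> z < \<rho> y" using N_rank by auto
    then obtain k' where k: "k = Suc k'" "\<rho> z \<le> k'" using step by (cases k) auto
    have "(y, z) \<in> R" using step N by auto
    with step.IH[OF k(2)] show ?case unfolding k by (rule relpow_Suc_I2[rotated])
  qed
  then have anc: "(a, b) \<in> R ^^ n" if "a \<in> V" "b \<in> ancestors a" for a b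
    using that n by (auto simp: ancestors_def)
  have sym: "(b, a) \<in> R ^^ k" if "(a, b) \<in> R ^^ k" for a b k
    using that
  proof (induction k arbitrary: b)
    case (Suc k)
    then obtain c where "(a, c) \<in> R ^^ k" "(c, b) \<in> R" by auto
    with Suc.IH R(1) show ?case by (meson relpow_Suc_I2 symD)
  qed simp
  have "{y \<in> L. ancestors x \<inter> ancestors y \<noteq> {}} \<subseteq> (R ^^ (n + n)) `` {x}"
  proof
    fix y assume "y \<in> {y \<in> L. ancestors x \<inter> ancestors y \<noteq> {}}"
    then obtain z where "y \<in> V" "z \<in> ancestors x" "z \<in> ancestors y" using L by auto
    then have "(x, z) \<in> R ^^ n" "(z, y) \<in> R ^^ n" using anc sym x by auto
    then show "y \<in> (R ^^ (n + n)) `` {x}" by (auto simp: relpow_add)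
  qed
  then have "card {y \<in> L. ancestors x \<inter> ancestors y \<noteq> {}} \<le> card ((R ^^ (n + n)) `` {x})"
    using card_relpow_Image_le[where R = R, OF R(3)] by (intro card_mono) auto
  also have "\<dots> \<le> m ^ (n + n)"
    using card_relpow_Image_le[where R = R, OF R(3)] by blast
  finally show ?thesis .
qed

end

section \<open>Choice of parameters\<close>

text \<open>Double counting, as in the Kovari-Sos-Turan theorem, of pairs \<open>(u, T)\<close>
  where \<open>u\<close> is heavy and \<open>T\<close> is a \<open>t\<close>-subset of
  \<open>F u \<inter> X\<close>.\<close>

lemma card_heavy_le:
  assumes X: "finite X"
    and free: "\<And>T. T \<subseteq> X \<Longrightarrow> card T = t \<Longrightarrow> card {u \<in> X. T \<subseteq> F u} \<le> s"
  shows "card {u \<in> X. D < card (F u \<inter> X)} * (D choose t) \<le> s * (card X choose t)"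
proof -
  let ?B = "{u \<in> X. D < card (F u \<inter> X)}" and ?T = "{T. T \<subseteq> X \<and> card T = t}"
  have finT: "finite ?T" using X by simp
  have "card ?B * (D choose t) = (\<Sum>u\<in>?B. D choose t)" by simp
  also have "\<dots> \<le> (\<Sum>u\<in>?B. card {T \<in> ?T. T \<subseteq> F u})"
  proof (rule sum_mono)
    fix u assume u: "u \<in> ?B"
    have "D choose t \<le> card (F u \<inter> X) choose t" using u by (intro binomial_right_mono) auto
    also have "\<dots> = card {T. T \<subseteq> F u \<inter> X \<and> card T = t}"
      using X by (intro n_subsets[symmetric]) auto
    also have "{T. T \<subseteq> F u \<inter> X \<and> card T = t} = {T \<in> ?T. T \<subseteq> F u}" by auto
    finally show "D choose t \<le> card {T \<in> ?T. T \<subseteq> F u}" .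
  qed
  also have "\<dots> = (\<Sum>T\<in>?T. card {u \<in> ?B. T \<subseteq> F u})"
    using X finT by (intro sum_multicount_gen) auto
  also have "\<dots> \<le> (\<Sum>T\<in>?T. s)"
  proof (rule sum_mono)
    fix T assume "T \<in> ?T"
    then have "card {u \<in> X. T \<subseteq> F u} \<le> s" using free by auto
    moreover have "card {u \<in> ?B. T \<subseteq> F u} \<le> card {u \<in> X. T \<subseteq> F u}"
      using X by (intro card_mono) auto
    ultimately show "card {u \<in> ?B. T \<subseteq> F u} \<le> s" by linarith
  qed
  also have "\<dots> = s * (card X choose t)" using n_subsets[OF X] by simp
  finally show ?thesis .
qed

lemma card_heavy_real_le:
  assumes X: "finite X" "card X \<le> d"
    and free: "\<And>T. T \<subseteq> X \<Longrightarrow> card T = t \<Longrightarrow> card {u \<in> X. T \<subseteq> F u} \<le> t"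
    and t: "1 \<le> t" "t \<le> D"
  shows "real (card {u \<in> X. D < card (F u \<inter> X)}) \<le> real t * (real d * real t / real D) ^ t"
proof -
  let ?B = "real (card {u \<in> X. D < card (F u \<inter> X)})"
  have heavy: "card {u \<in> X. D < card (F u \<inter> X)} * (D choose t) \<le> t * (card X choose t)"
    by (rule card_heavy_le[OF X(1) free])
  have "?B * (real D / real t) ^ t \<le> ?B * real (D choose t)"
    using binomial_ge_n_over_k_pow_k[OF t(2), where 'a = real] by (intro mult_left_mono) auto
  also have "\<dots> \<le> real t * real (card X choose t)"
    using of_nat_mono[OF heavy, where 'a = real] by simp
  also have "\<dots> \<le> real t * real d ^ t"
  proof (rule mult_left_mono)
    have "card X choose t \<le> d choose t" using X by (intro binomial_right_mono)
    also have "\<dots> \<le> d ^ t"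
    proof (cases "t \<le> d")
      case True then show ?thesis by (rule binomial_le_pow)
    qed (simp add: binomial_eq_0)
    finally show "real (card X choose t) \<le> real d ^ t" by (metis of_nat_le_iff of_nat_power)
  qed simp
  finally have "?B \<le> real t * real d ^ t / (real D / real t) ^ t"
    using t by (simp add: pos_le_divide_eq)
  then show ?thesis by (simp add: power_divide power_mult_distrib)
qed

lemma inverse_power_le_exp:
  fixes x :: real
  assumes "0 \<le> x" "x < 1"
  shows "(1 / (1 - x)) ^ D \<le> exp (real D * x / (1 - x))"
proof -
  have "1 / (1 - x) = 1 + x / (1 - x)" using assms by (simp add: field_simps)
  also have "\<dots> \<le> exp (x / (1 - x))" by (rule exp_ge_add_one_self)
  finally have "(1 / (1 - x)) ^ D \<le> exp (x / (1 - x)) ^ D"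
    using assms by (intro power_mono) auto
  also have "\<dots> = exp (real D * x / (1 - x))" by (simp add: exp_of_nat_mult[symmetric])
  finally show ?thesis .
qed

text \<open>The biased mean of the weight sum is at most about
  \<open>0.57 * \<alpha> * ln d\<close>, while the cap tolerates
  \<open>\<mu> \<ge> 0.97 * \<alpha> * ln d\<close>. Markov's inequality then loses at most
  \<open>6 / 10\<close>, and \<open>4 / 10 * p\<close> is the bound claimed.\<close>

lemma eventually_parameters:
  fixes t :: nat
  assumes "1 \<le> t"
  shows "\<forall>\<^sub>F d in sequentially. \<exists>D p \<tau> \<mu>. 0 < p \<and> 0 \<le> \<tau> \<and> \<tau> < 1 \<and> 0 < \<mu> \<and> t \<le> D \<and>
    p * exp ((\<mu> + real t * (real d * real t / real D) ^ t * \<tau>) / (1 - \<tau>)) \<le> \<tau> \<and>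
    ln (real d) / (15 * real t * real d) \<le> p * (1 - real d * p * (1 / (1 - \<tau>)) ^ D / \<mu>)"
proof -
  define \<alpha> where "\<alpha> = 1 / (3 * real t)"
  have \<alpha>: "0 < \<alpha>" "\<alpha> \<le> 1 / 3" "\<alpha> * real t = 1 / 3" using assms by (auto simp: \<alpha>_def field_simps)
  \<comment> \<open>With this \<open>\<tau>\<close> and \<open>D\<close> of order
    \<open>1 / \<tau>\<close>, the bound on the number of exceptional vertices is of order
    \<open>d powr (\<alpha> * t) = d powr (1 / 3)\<close>, so their total contribution to the weight
    sum tends to \<open>0\<close>.\<close>
  define \<tau> where "\<tau> d = real d powr (\<alpha> - 1)" for d :: nat
  \<comment> \<open>Here \<open>d * p\<close> is half the leading term of \<open>\<mu>\<close>,
    which to leading order maximises \<open>p * (1 - d * p / \<mu>)\<close>.\<close>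
  define p where "p d = \<alpha> / 2 * ln (real d) / real d" for d :: nat
  \<comment> \<open>The cap condition solved for \<open>\<mu>\<close>, with 1 set aside for the
    exceptional vertices.\<close>
  define \<mu> where "\<mu> d = (1 - \<tau> d) * ln (\<tau> d / p d) - 1" for d :: nat
  \<comment> \<open>As \<open>D * \<tau>\<close> is close to \<open>1 / 10\<close>, the drift factor
    \<open>(1 / (1 - \<tau>)) ^ D\<close> stays below \<open>1.14\<close>.\<close>
  define D where "D d = nat \<lceil>1 / (10 * \<tau> d)\<rceil>" for d :: nat
  define C where "C = real t * (10 * real t) ^ t"
  have 1: "\<forall>\<^sub>F d :: nat in sequentially. 1 < d" by (rule eventually_gt_at_top)
  have "(\<lambda>d::nat. real d powr (\<alpha> - 1)) \<longlonglongrightarrow> 0" using \<alpha> by real_asymp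
  then have \<tau>0: "\<forall>\<^sub>F d in sequentially. \<tau> d < c" if "0 < c" for c
    unfolding \<tau>_def using that by (rule order_tendstoD)
  have 2: "\<forall>\<^sub>F d in sequentially. \<tau> d < 1 / 100" by (rule \<tau>0) simp
  have 3: "\<forall>\<^sub>F d in sequentially. \<tau> d < 1 / (10 * real t)" using assms by (intro \<tau>0) simp
  have "(\<lambda>d::nat. C * real d powr (1 / 3) * real d powr (\<alpha> - 1)) \<longlonglongrightarrow> 0" using \<alpha> by real_asymp
  then have 4: "\<forall>\<^sub>F d in sequentially. C * real d powr (1 / 3) * \<tau> d < 1"
    unfolding \<tau>_def by (rule order_tendstoD) simp
  have "\<forall>\<^sub>F d :: nat in sequentially. 97 / 100 * (\<alpha> * ln (real d)) \<le>
    (1 - real d powr (\<alpha> - 1)) * (\<alpha> * ln (real d) - ln (\<alpha> / 2) - ln (ln (real d))) - 1"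
    using \<alpha> by real_asymp
  then show ?thesis using 1 2 3 4
  proof eventually_elim
    case (elim d)
    have d: "0 < real d" "0 < ln (real d)" using elim by auto
    have \<tau>: "0 < \<tau> d" "\<tau> d < 1" using d elim by (auto simp: \<tau>_def)
    have p: "0 < p d" using d \<alpha> by (simp add: p_def)
    have "ln (\<tau> d / p d) = ln (\<tau> d) - ln (p d)" using \<tau> p by (simp add: ln_div)
    also have "ln (p d) = ln (\<alpha> / 2) + ln (ln (real d)) - ln (real d)"
      using d \<alpha> by (simp add: p_def ln_div ln_mult)
    also have "ln (\<tau> d) = (\<alpha> - 1) * ln (real d)" using d by (simp add: \<tau>_def ln_powr)
    finally have l: "ln (\<tau> d / p d) = \<alpha> * ln (real d) - ln (\<alpha> / 2) - ln (ln (real d))"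
      by (simp add: algebra_simps)
    have "\<mu> d = (1 - \<tau> d) * (\<alpha> * ln (real d) - ln (\<alpha> / 2) - ln (ln (real d))) - 1"
      unfolding \<mu>_def l ..
    then have \<mu>: "97 / 100 * (\<alpha> * ln (real d)) \<le> \<mu> d" using elim(1) by (simp add: \<tau>_def)
    have \<alpha>l: "0 < \<alpha> * ln (real d)" using \<alpha> d by simp
    have \<mu>0: "0 < \<mu> d" using \<mu> \<alpha>l by linarith
    have "real (D d) = real_of_int \<lceil>1 / (10 * \<tau> d)\<rceil>"
      using \<tau> by (simp add: D_def)
    then have D: "1 / (10 * \<tau> d) \<le> real (D d)" "real (D d) \<le> 1 / (10 * \<tau> d) + 1"
      by linarith+
    have "real t < 1 / (10 * \<tau> d)" using elim(4) \<tau> assms by (simp add: field_simps)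
    then have tD: "t \<le> D d" using D by linarith
    have D0: "0 < real (D d)" using tD assms by simp
    have "real d * real t / real (D d) \<le> real d * real t / (1 / (10 * \<tau> d))"
      using D \<tau> D0 by (intro divide_left_mono mult_pos_pos) auto
    also have "\<dots> = 10 * real t * real d powr \<alpha>"
      using d by (simp add: \<tau>_def powr_diff)
    finally have "real t * (real d * real t / real (D d)) ^ t \<le> real t * (10 * real t * real d powr \<alpha>) ^ t"
      by (intro mult_left_mono power_mono) auto
    also have "(10 * real t * real d powr \<alpha>) ^ t = (10 * real t) ^ t * real d powr (\<alpha> * real t)"
      using d by (simp add: power_mult_distrib powr_power mult.commute)
    also have "real t * \<dots> = C * real d powr (1 / 3)"
      unfolding \<alpha>(3) by (simp add: C_def)
    finally have "real t * (real d * real t / real (D d)) ^ t * \<tau> d \<le> C * real d powr (1 / 3) * \<tau> d"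
      using \<tau> by (intro mult_right_mono) auto
    then have "\<mu> d + real t * (real d * real t / real (D d)) ^ t * \<tau> d \<le> (1 - \<tau> d) * ln (\<tau> d / p d)"
      using elim(5) by (simp add: \<mu>_def)
    then have "(\<mu> d + real t * (real d * real t / real (D d)) ^ t * \<tau> d) / (1 - \<tau> d) \<le> ln (\<tau> d / p d)"
      using \<tau> by (simp add: pos_divide_le_eq mult.commute)
    then have "exp ((\<mu> d + real t * (real d * real t / real (D d)) ^ t * \<tau> d) / (1 - \<tau> d)) \<le> \<tau> d / p d"
      using \<tau> p by (metis divide_pos_pos exp_le_cancel_iff exp_ln)
    then have A: "p d * exp ((\<mu> d + real t * (real d * real t / real (D d)) ^ t * \<tau> d) / (1 - \<tau> d)) \<le> \<tau> d"
      using p by (simp add: pos_le_divide_eq mult.commute)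
    have "real (D d) * \<tau> d \<le> (1 / (10 * \<tau> d) + 1) * \<tau> d"
      using D \<tau> by (intro mult_right_mono) auto
    also have "\<dots> = 1 / 10 + \<tau> d" using \<tau> by (simp add: field_simps)
    also have "\<dots> \<le> 12 / 100 * (1 - \<tau> d)" using elim(3) by simp
    finally have "real (D d) * \<tau> d / (1 - \<tau> d) \<le> 12 / 100" using \<tau> by (simp add: pos_divide_le_eq)
    then have "exp (real (D d) * \<tau> d / (1 - \<tau> d)) \<le> exp (12 / 100)" by simp
    also have "exp (12 / 100 :: real) \<le> 1 + 12 / 100 + (12 / 100)\<^sup>2" by (rule exp_bound) auto
    finally have pw: "(1 / (1 - \<tau> d)) ^ D d \<le> 114 / 100"
      using inverse_power_le_exp[of "\<tau> d" "D d"] \<tau> by (simp add: power2_eq_square)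
    have dp: "real d * p d = \<alpha> / 2 * ln (real d)" using d by (simp add: p_def)
    have "real d * p d * (1 / (1 - \<tau> d)) ^ D d \<le> (\<alpha> / 2 * ln (real d)) * (114 / 100)"
      unfolding dp using \<alpha>l by (intro mult_left_mono pw) simp
    also have "\<dots> \<le> 6 / 10 * (97 / 100 * (\<alpha> * ln (real d)))" using \<alpha>l by simp
    also have "\<dots> \<le> 6 / 10 * \<mu> d" using \<mu> by simp
    finally have "real d * p d * (1 / (1 - \<tau> d)) ^ D d / \<mu> d \<le> 6 / 10"
      using \<mu>0 by (simp add: pos_divide_le_eq)
    then have B: "p d * (4 / 10) \<le> p d * (1 - real d * p d * (1 / (1 - \<tau> d)) ^ D d / \<mu> d)"
      using p by (intro mult_left_mono) auto
    have e: "p d * (4 / 10) = ln (real d) / (15 * real t * real d)"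
      by (simp add: p_def \<alpha>_def)
    from B[unfolded e] A p \<tau> \<mu>0 tD show ?case by (meson less_imp_le)
  qed
qed

section \<open>Colorings of covers\<close>

text \<open>Disjointness of \<open>A\<close>, \<open>B\<close> and \<open>{v}\<close> comes for
  free: an overlap would give a loop in \<open>G\<close>.\<close>

lemma tripartite_freeD:
  fixes G :: "'a pair_pre_digraph"
  assumes G: "pair_graph G" and free: "tripartite_free 1 t t G" and t: "1 \<le> t"
    and AB: "finite A" "finite B" "card A = t" "card B = t"
    and v: "\<And>a. a \<in> A \<union> B \<Longrightarrow> (v, a) \<in> parcs G"
    and ab: "\<And>a b. a \<in> A \<Longrightarrow> b \<in> B \<Longrightarrow> (a, b) \<in> parcs G"
  shows False
proof -
  interpret G: pair_graph G by (rule G)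
  have symG: "(y, x) \<in> parcs G" if "(x, y) \<in> parcs G" for x y
    using G.pair_sym_arcs that by (auto simp: symmetric_def dest: symD)
  have loop: "(x, x) \<notin> parcs G" for x using G.pair_no_loops[of "(x, x)"] by auto
  obtain a where "a \<in> A" using AB t by fastforce
  with v have v_in: "v \<in> pverts G" using G.in_arcsD1 by blast
  have sub: "A \<union> B \<subseteq> pverts G" using v G.in_arcsD2 by blast
  have dis: "A \<inter> B = {}" "v \<notin> A" "v \<notin> B" using ab v loop by blast+
  define K where "K = \<lparr>pverts = {v} \<union> A \<union> B,
    parcs = {v} \<times> A \<union> A \<times> {v} \<union> {v} \<times> B \<union> B \<times> {v} \<union> A \<times> B \<union> B \<times> A\<rparr>"
  have K: "pair_graph K"
  proof unfold_locales
    show "symmetric (with_proj K)"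
      by (auto simp: symmetric_def K_def intro!: symI)
  qed (use AB dis in \<open>auto simp: K_def\<close>)
  then interpret K: pair_graph K .
  have "parcs K \<subseteq> parcs G"
    using v ab symG by (auto simp: K_def)
  then have "subgraph (with_proj K) (with_proj G)"
    using v_in sub G.wf_digraph K.wf_digraph unfolding subgraph_def by (auto simp: K_def)
  moreover have "complete_tripartite_digraph 1 t t K"
    unfolding complete_tripartite_digraph_def
    by (rule conjI[OF K], rule exI[of _ "{v}"], rule exI[of _ A], rule exI[of _ B])
      (use AB dis in \<open>auto simp: K_def\<close>)
  ultimately show False using free by (auto simp: tripartite_free_def)
qed

text \<open>The greedy process runs on the vertices of \<open>H\<close>, ranked by the position in
  the degeneracy order of the vertex whose list contains them. The condition on \<open>q\<close> is
  the one for concentration, with \<open>Suc n ^ (n + n)\<close> bounding the dependence.\<close>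

lemma dp_coloring_exists:
  fixes G :: "'a pair_pre_digraph" and H :: "'b pair_pre_digraph" and \<eta> p \<tau> \<mu> :: real
  assumes G: "pair_graph G" and deg: "degenerate d G"
    and free: "tripartite_free 1 t t G" and t: "1 \<le> t" "t \<le> D"
    and par: "0 < p" "0 \<le> \<tau>" "\<tau> < 1" "0 < \<mu>"
      "p * exp ((\<mu> + real t * (real d * real t / real D) ^ t * \<tau>) / (1 - \<tau>)) \<le> \<tau>"
    and \<eta>: "\<eta> < \<eta>'" "\<eta>' \<le> p * (1 - real d * p * (1 / (1 - \<tau>)) ^ D / \<mu>)"
    and cov: "fold_dp_cover q G L H" and n: "n = card (pverts G)"
    and q: "real n * real (Suc n ^ (n + n)) < (\<eta>' - \<eta>)\<^sup>2 * real q" "0 < q"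
  shows "\<exists>S. dp_coloring \<eta> G L H S"
proof -
  have pgH: "pair_graph H" and un: "(\<Union>v\<in>pverts G. L v) = pverts H"
    and dis: "disjoint_family_on L (pverts G)"
    and ind: "\<And>v. v \<in> pverts G \<Longrightarrow> independent_set H (L v)"
    and card_L: "\<And>v. v \<in> pverts G \<Longrightarrow> card (L v) = q"
    using cov by (auto simp: fold_dp_cover_def dp_cover_def)
  have sv: "y = z" if "u \<in> pverts G" "v \<in> pverts G" "u \<noteq> v" "x \<in> L u" "y \<in> L v" "z \<in> L v"
    "(x, y) \<in> parcs H" "(x, z) \<in> parcs H" for u v x y z
  proof -
    have "single_valued (arcs (with_proj H \<restriction> (L u \<union> L v)))"
      using cov that(1-3) unfolding fold_dp_cover_def dp_cover_def by auto
    moreover have "(x, y) \<in> arcs (with_proj H \<restriction> (L u \<union> L v))"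
      "(x, z) \<in> arcs (with_proj H \<restriction> (L u \<union> L v))"
      using that by (auto simp: induce_subgraph_def)
    ultimately show ?thesis by (rule single_valuedD)
  qed
  have emp: "(u, v) \<in> parcs G" if "u \<in> pverts G" "v \<in> pverts G" "u \<noteq> v" "x \<in> L u" "y \<in> L v"
    "(x, y) \<in> parcs H" for u v x y
  proof (rule ccontr)
    assume "(u, v) \<notin> parcs G"
    then have "arcs (with_proj H \<restriction> (L u \<union> L v)) = {}"
      using cov that(1-3) unfolding fold_dp_cover_def dp_cover_def by auto
    moreover have "(x, y) \<in> arcs (with_proj H \<restriction> (L u \<union> L v))"
      using that by (auto simp: induce_subgraph_def)
    ultimately show False by blast
  qed
  interpret G: pair_graph G by (rule G)
  interpret H: pair_graph H by (rule pgH)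
  have symH: "(y, x) \<in> parcs H" if "(x, y) \<in> parcs H" for x y
    using H.pair_sym_arcs that by (auto simp: symmetric_def dest: symD)
  obtain vs where vs: "distinct vs" "set vs = pverts G"
    and vs_deg: "\<And>i. i < length vs \<Longrightarrow> card {u \<in> set (take i vs). (u, vs ! i) \<in> parcs G} \<le> d"
    using deg unfolding degenerate_def by blast
  have len: "length vs = n" using vs n distinct_card by fastforce
  have "\<exists>i<n. x \<in> L (vs ! i)" if "x \<in> pverts H" for x
    using that un vs(2) len by (metis UN_E in_set_conv_nth)
  then obtain pos where pos: "\<And>x. x \<in> pverts H \<Longrightarrow> pos x < n \<and> x \<in> L (vs ! pos x)"
    by metis
  have vert: "vs ! i \<in> pverts G" if "i < n" for i using that vs len nth_mem by blast
  have neq: "vs ! i \<noteq> vs ! j" if "i < n" "j < n" "i \<noteq> j" for i j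
    using that vs(1) len by (simp add: nth_eq_iff_index_eq)
  have arc: "x \<in> pverts H" "y \<in> pverts H" "pos x \<noteq> pos y" "(vs ! pos x, vs ! pos y) \<in> parcs G"
    if xy: "(x, y) \<in> parcs H" for x y
  proof -
    show x: "x \<in> pverts H" and y: "y \<in> pverts H" using H.wellformed'[OF xy] by auto
    show ne: "pos x \<noteq> pos y"
    proof
      assume "pos x = pos y"
      then have "x \<in> L (vs ! pos x)" "y \<in> L (vs ! pos x)" using pos x y by metis+
      with ind[OF vert, of "pos x"] pos[OF x] xy show False by (auto simp: independent_set_def)
    qed
    show "(vs ! pos x, vs ! pos y) \<in> parcs G"
      using pos[OF x] pos[OF y] ne xy by (intro emp[of _ _ x y] vert neq) auto
  qed
  \<comment> \<open>By the matching condition, \<open>x\<close> has at most one neighbour in each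
    other list. Neighbourhoods in \<open>H\<close> therefore project injectively to
    \<open>G\<close>, which carries degree bounds and forbidden subgraphs over to
    \<open>H\<close>.\<close>
  have inj: "inj_on (\<lambda>y. vs ! pos y) {y. (x, y) \<in> parcs H}" for x
  proof (rule inj_onI)
    fix y z assume yz: "y \<in> {y. (x, y) \<in> parcs H}" "z \<in> {y. (x, y) \<in> parcs H}"
      and eq: "vs ! pos y = vs ! pos z"
    then have xy: "(x, y) \<in> parcs H" "(x, z) \<in> parcs H" by auto
    note x = pos[OF arc(1)[OF xy(1)]] and y = pos[OF arc(2)[OF xy(1)]]
      and z = pos[OF arc(2)[OF xy(2)]]
    show "y = z"
      using x y z eq xy arc(3)[OF xy(1)] by (intro sv[of "vs ! pos x" "vs ! pos y" x] vert neq) auto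
  qed

  define N where "N x = {y. (y, x) \<in> parcs H \<and> pos y < pos x}" for x
  have N_sub: "N x \<subseteq> {y. (x, y) \<in> parcs H}" for x using symH by (auto simp: N_def)
  have N_inj: "inj_on (\<lambda>y. vs ! pos y) (N x)" for x by (rule inj_on_subset[OF inj N_sub])
  interpret greedy_process "pverts H" N pos p \<tau>
    using par arc by unfold_locales (auto simp: N_def)
  have finN: "finite (N x)" for x
    by (rule finite_subset[OF _ finite_V]) (use arc in \<open>auto simp: N_def\<close>)

  have card_N: "card (N x) \<le> d" if x: "x \<in> pverts H" for x
  proof -
    have "card (N x) = card ((\<lambda>y. vs ! pos y) ` N x)" using card_image[OF N_inj] by simp
    also have "(\<lambda>y. vs ! pos y) ` N x \<subseteq> {u \<in> set (take (pos x) vs). (u, vs ! pos x) \<in> parcs G}"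
    proof (rule image_subsetI)
      fix y assume y: "y \<in> N x"
      then have "pos y < pos x" "pos x < n" "(vs ! pos y, vs ! pos x) \<in> parcs G"
        using pos[OF x] arc(4)[of y x] by (auto simp: N_def)
      then show "vs ! pos y \<in> {u \<in> set (take (pos x) vs). (u, vs ! pos x) \<in> parcs G}"
        using len by (auto simp: in_set_conv_nth intro!: exI[of _ "pos y"])
    qed
    then have "card ((\<lambda>y. vs ! pos y) ` N x) \<le> card {u \<in> set (take (pos x) vs). (u, vs ! pos x) \<in> parcs G}"
      by (intro card_mono) auto
    also have "\<dots> \<le> d" using vs_deg pos[OF x] len by simp
    finally show ?thesis .
  qed

  \<comment> \<open>Otherwise \<open>x\<close>, \<open>T\<close> and \<open>t\<close> of these
    vertices \<open>u\<close> would project to a copy of \<open>K_{1,t,t}\<close> in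
    \<open>G\<close>.\<close>
  have free_N: "card {u \<in> N x. T \<subseteq> N u} \<le> t" if T: "T \<subseteq> N x" "card T = t" for x T
  proof (rule ccontr)
    assume "\<not> ?thesis"
    then obtain U where U: "U \<subseteq> {u \<in> N x. T \<subseteq> N u}" "card U = t"
      using obtain_subset_with_card_n[of t "{u \<in> N x. T \<subseteq> N u}"] by auto
    have sub: "T \<subseteq> N x" "U \<subseteq> N x" using T U by auto
    let ?f = "\<lambda>y. vs ! pos y"
    show False
    proof (rule tripartite_freeD[OF G free t(1)])
      show "finite (?f ` T)" "finite (?f ` U)" using sub finN finite_subset by blast+
      show "card (?f ` T) = t" "card (?f ` U) = t"
        using T U sub card_image[OF inj_on_subset[OF N_inj]] by metis+
      show "(?f x, a) \<in> parcs G" if "a \<in> ?f ` T \<union> ?f ` U" for a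
        using that sub N_sub[of x] arc(4)[of x] by blast
      show "(a, b) \<in> parcs G" if "a \<in> ?f ` T" "b \<in> ?f ` U" for a b
        using that U arc(4) by (auto simp: N_def)
    qed
  qed

  \<comment> \<open>The exceptional set consists of those \<open>u \<in> N x\<close> with more than
    \<open>D\<close> elements of \<open>N x\<close> in \<open>N u\<close>; \<open>free_N\<close>
    bounds its size.\<close>
  have prob: "\<eta>' \<le> prob_mem x" if x: "x \<in> pverts H" for x
    unfolding expect_def
    using card_heavy_real_le[where F = N and X = "N x", OF finN card_N[OF x] free_N t]
    by (intro order.trans[OF \<eta>(2) prob_mem_ge[OF x card_N[OF x], where
        B = "{u \<in> N x. D < card (N u \<inter> N x)}" and
        b = "real t * (real d * real t / real D) ^ t"]] par) auto

  \<comment> \<open>Adding \<open>Id\<close> makes the relation reflexive, at the cost of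
    \<open>Suc n\<close> instead of \<open>n\<close>.\<close>
  have R: "finite ((Id \<union> parcs H) `` {x}) \<and> card ((Id \<union> parcs H) `` {x}) \<le> Suc n" for x
  proof -
    have "(\<lambda>y. vs ! pos y) ` {y. (x, y) \<in> parcs H} \<subseteq> pverts G"
      using pos arc vert by blast
    then have "card {y. (x, y) \<in> parcs H} \<le> n"
      unfolding n by (rule card_inj_on_le[OF inj _ G.pair_finite_verts])
    moreover have "finite {y. (x, y) \<in> parcs H}"
      by (rule finite_subset[OF _ finite_V]) (use arc in auto)
    moreover have "(Id \<union> parcs H) `` {x} = insert x {y. (x, y) \<in> parcs H}" by auto
    ultimately show ?thesis by (simp add: card_insert_if)
  qed
  have L_sub: "L v \<subseteq> pverts H" if "v \<in> pverts G" for v using un that by blast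
  have "card {y \<in> L v. ancestors x \<inter> ancestors y \<noteq> {}} \<le> Suc n ^ (n + n)"
    if "v \<in> pverts G" "x \<in> L v" for v x
  proof (rule card_dependent_le[where R = "Id \<union> parcs H"])
    show "sym (Id \<union> parcs H)" using symH by (auto intro: symI)
    show "pos x \<le> n" if "x \<in> pverts H" for x using pos[OF that] by simp
  qed (use R L_sub that symH in \<open>auto simp: N_def refl_on_def\<close>)
  then obtain S where S: "S \<subseteq> pverts H" "seq_weight select (pverts H) S \<noteq> 0"
    and S_card: "\<And>v. v \<in> pverts G \<Longrightarrow> \<eta> * real q \<le> real (card (S \<inter> L v))"
    using exists_concentrated[of "pverts G" L q "Suc n ^ (n + n)" \<eta>' \<eta>] L_sub card_L prob \<eta>(1) q
      G.pair_finite_verts n by blast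
  have "(x, y) \<notin> parcs H" if xy: "x \<in> S" "y \<in> S" for x y
  proof
    assume a: "(x, y) \<in> parcs H"
    then have "y \<in> N x \<or> x \<in> N y" using arc(3)[OF a] symH by (auto simp: N_def)
    then show False using support_independent[OF S] xy by blast
  qed
  then have "dp_coloring \<eta> G L H S"
    using S(1) S_card card_L by (auto simp: dp_coloring_def independent_set_def)
  then show ?thesis by blast
qed

theorem corollary1p15:
  fixes t :: nat
  assumes "t \<ge> 1"
  shows "\<exists>(d0 :: nat) (\<epsilon> :: nat \<Rightarrow> real). \<epsilon> \<longlonglongrightarrow> 0 \<and>
           (\<forall>d \<ge> d0. \<forall>G :: 'a pair_pre_digraph.
              pair_graph G \<longrightarrow> degenerate d G \<longrightarrow> tripartite_free 1 t t G \<longrightarrow>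
              frac_dp_chromatic G \<le> ereal ((16 * real t + \<epsilon> d) * (real d / ln (real d))))"
proof -
  obtain d1 where d1: "\<And>d. d1 \<le> d \<Longrightarrow> \<exists>D p \<tau> \<mu>. 0 < p \<and> 0 \<le> \<tau> \<and> \<tau> < 1 \<and> 0 < \<mu> \<and> t \<le> D \<and>
    p * exp ((\<mu> + real t * (real d * real t / real D) ^ t * \<tau>) / (1 - \<tau>)) \<le> \<tau> \<and>
    ln (real d) / (15 * real t * real d) \<le> p * (1 - real d * p * (1 / (1 - \<tau>)) ^ D / \<mu>)"
    using eventually_parameters[OF assms] unfolding eventually_sequentially by blast
  have "frac_dp_chromatic G \<le> ereal (16 * real t * (real d / ln (real d)))"
    if d: "max d1 2 \<le> d" and G: "pair_graph G" "degenerate d G" "tripartite_free 1 t t G"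
    for d and G :: "'a pair_pre_digraph"
  proof -
    have l: "0 < ln (real d)" "0 < real d" "0 < real t" using d assms by auto
    \<comment> \<open>The gap between \<open>16\<close> and \<open>15\<close> is the slack spent on
      concentration.\<close>
    define \<eta> where "\<eta> = ln (real d) / (16 * real t * real d)"
    define \<eta>' where "\<eta>' = ln (real d) / (15 * real t * real d)"
    define n where "n = card (pverts G)"
    have \<eta>: "0 < \<eta>" "\<eta> < \<eta>'"
      using l by (auto simp: \<eta>_def \<eta>'_def intro!: divide_strict_left_mono mult_pos_pos)
    have "ln (real d) \<le> 16 * real t * real d"
    proof -
      have "ln (real d) \<le> real d" using ln_le_minus_one[of "real d"] l by linarith
      also have "\<dots> \<le> 16 * real t * real d" using l assms by simp
      finally show ?thesis .
    qed
    then have \<eta>1: "\<eta> \<le> 1" using l by (simp add: \<eta>_def)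
    obtain D p \<tau> \<mu> where par: "t \<le> D" "0 < p" "0 \<le> \<tau>" "\<tau> < 1" "0 < \<mu>"
      "p * exp ((\<mu> + real t * (real d * real t / real D) ^ t * \<tau>) / (1 - \<tau>)) \<le> \<tau>"
      "\<eta>' \<le> p * (1 - real d * p * (1 / (1 - \<tau>)) ^ D / \<mu>)"
      using d1[of d] d unfolding \<eta>'_def by auto
    have "0 < (\<eta>' - \<eta>)\<^sup>2" using \<eta> by simp
    \<comment> \<open>This \<open>q\<close> may depend on \<open>G\<close>: the fractional number is
      an infimum over all \<open>q\<close>, so a single good one suffices.\<close>
    then obtain q :: nat where q: "real n * real (Suc n ^ (n + n)) < real q * (\<eta>' - \<eta>)\<^sup>2"
      using reals_Archimedean3 by blast
    then have "0 < real q * (\<eta>' - \<eta>)\<^sup>2" by (rule order.strict_trans1[rotated]) simp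
    then have q0: "0 < q" by (simp add: zero_less_mult_iff)
    have "dp_colorable \<eta> G q"
      unfolding dp_colorable_def
      using dp_coloring_exists[OF G assms par(1-6) \<eta>(2) par(7) _ n_def
          q[unfolded mult.commute[of "real q"]] q0] by blast
    then have th: "\<eta> \<le> theta_dp G q"
      using \<eta> \<eta>1 by (intro theta_dp_is_maximum) auto
    have "frac_dp_chromatic G \<le> inverse (ereal (theta_dp G q))"
      unfolding frac_dp_chromatic_def using q0 by (intro INF_lower) auto
    also have "\<dots> \<le> inverse (ereal \<eta>)"
      using th \<eta> by (intro ereal_inverse_antimono) auto
    also have "\<dots> = ereal (16 * real t * (real d / ln (real d)))"
      using \<eta> l by (simp add: \<eta>_def field_simps)
    finally show ?thesis .
  qed
  then show ?thesis
    by (intro exI[of _ "max d1 2"] exI[of _ "\<lambda>_. 0"]) simp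
qed

end
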